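(* Let $G$ be a finite abelian group and let $n\ge 5$ be odd such that $\mathcal{L}\big(\mathcal{B}_{\pm}(G)\big)=\mathcal{L}\big(\mathcal{B}_{\pm}(C_n)\big)$. Then $G\cong C_n$.
   Context: $C_n$ denotes an additive cyclic group with $n$ elements. For an additive abelian group $G$, $\mathcal{F}(G)$ is the multiplicatively written free abelian monoid with basis $G$; its elements $S=g_1\cdot\ldots\cdot g_\ell$ are called sequences over $G$. $\mathcal{B}_{\pm}(G)\subset\mathcal{F}(G)$ is the submonoid of all plus-minus weighted zero-sum sequences, i.e. all $S=g_1\cdot\ldots\cdot g_\ell$ for which there are $\varepsilon_1,\ldots,\varepsilon_\ell\in\{-1,1\}$ with $\varepsilon_1g_1+\ldots+\varepsilon_\ell g_\ell=0$ in $G$ (the empty sequence is included). For a monoid $H$ and a non-invertible $a\in H$, the set of lengths $\mathsf{L}(a)\subset\mathbb{N}$ is the set of all $k$ such that $a=u_1\cdot\ldots\cdot u_k$ for some atoms (irreducible elements) $u_1,\ldots,u_k$ of $H$; for invertible $a$ one sets $\mathsf{L}(a)=\{0\}$. The system of sets of lengths is $\mathcal{L}(H)=\{\mathsf{L}(a)\colon a\in H\}$. *)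

theory Defs
  imports "HOL-Algebra.FiniteProduct" "HOL-Algebra.Divisibility" "HOL-Algebra.Elementary_Groups"
begin

text \<open>
  Groups are written multiplicatively, as usual in HOL-Algebra: the weighted sum
  \<open>\<epsilon>\<^sub>1 g\<^sub>1 + \<dots> + \<epsilon>\<^sub>\<ell> g\<^sub>\<ell>\<close> becomes a product of powers with exponents \<open>\<epsilon>\<^sub>i \<in> {-1, 1}\<close>.
  A sequence over \<open>G\<close> is a finite multiset of elements of \<open>carrier G\<close>, and the product of
  sequences is the sum of multisets. The listing \<open>gs\<close> of the terms lets different
  occurrences of the same element carry different signs.
\<close>

definition pm_zero_sum :: "('a, 'b) monoid_scheme \<Rightarrow> 'a multiset \<Rightarrow> bool" where
  "pm_zero_sum G S \<longleftrightarrow>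
    (\<exists>gs (\<epsilon> :: nat \<Rightarrow> int). mset gs = S \<and> (\<forall>i < length gs. \<epsilon> i \<in> {-1, 1}) \<and>
      (\<Otimes>\<^bsub>G\<^esub>i\<in>{..<length gs}. (gs ! i) [^]\<^bsub>G\<^esub> \<epsilon> i) = \<one>\<^bsub>G\<^esub>)"

definition pm_zero_sum_monoid :: "('a, 'b) monoid_scheme \<Rightarrow> 'a multiset monoid" where
  "pm_zero_sum_monoid G =
    \<lparr>carrier = {S. set_mset S \<subseteq> carrier G \<and> pm_zero_sum G S}, monoid.mult = (+), one = {#}\<rparr>"

text \<open>
  The library predicate \<^const>\<open>irreducible\<close> does not itself require membership in the carrier,
  hence the explicit condition on the factors.
\<close>

definition set_of_lengths :: "('a, 'b) monoid_scheme \<Rightarrow> 'a \<Rightarrow> nat set" where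
  "set_of_lengths H a =
    (if a \<in> Units H then {0}
     else {length us | us. set us \<subseteq> carrier H \<and> factors H us a})"

definition system_of_sets_of_lengths :: "('a, 'b) monoid_scheme \<Rightarrow> nat set set" where
  "system_of_sets_of_lengths H = set_of_lengths H ` carrier H"

end

theory Submission
  imports Defs "HOL-Algebra.Multiplicative_Group"
begin

text \<open>
  In \<open>\<B>\<^sub>\<plusminus>(G)\<close> every pair \<open>g g\<close> is zero-sum, so for an
  atom \<open>V\<close> avoiding the identity \<open>V\<^sup>2\<close> has factorizations of lengths \<open>2\<close> and \<open>|V|\<close>, and the sizes of
  the atoms are read off from the sets of lengths (\<open>atom_bound_transfer\<close>). For \<open>g\<close> of odd order \<open>p\<close>
  the sequence \<open>g\<^sup>p\<close> is an atom. If \<open>g\<close> occurs in a sequence at least \<open>3 p\<close> times, then \<open>2 p\<close>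
  copies of it split off and the exchange \<open>g\<^sup>p g\<^sup>p = (g g) \<dots> (g g)\<close> yields two lengths whose difference is
  \<open>p - 2\<close>, an odd number (\<open>odd_order_exchange\<close>). By the pigeonhole principle a set of lengths
  that spreads over a sufficiently large range always comes from a sequence with such a frequent element
  \<open>g \<noteq> \<one>\<close> (\<open>frequent_element\<close>).

  The sets of lengths that are fed into this machine are those of \<open>V\<^bsup>2k\<^esup>\<close> for a marked atom \<open>V\<close>:
  an atom without the identity such that all atoms over its support are pairs or have size \<open>|V|\<close>, the two kinds
  being told apart by the parity of the multiplicity of a marker element. Every length of \<open>V\<^bsup>2k\<^esup>\<close> is
  congruent to \<open>2 k\<close> modulo \<open>|V| - 2\<close>, while \<open>2 k\<close> and \<open>k |V|\<close> both occur
  (\<open>marked_atom_lengths\<close>). Hence, if all elements of the finite group \<open>H\<close> have odd order, every set of lengths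
  of \<open>G\<close> is one of \<open>H\<close> and \<open>|V| \<ge> 4\<close>, then \<open>|V| - 2\<close> divides \<open>p - 2\<close> for the order \<open>p > 1\<close> of some element of \<open>H\<close>
  (\<open>marked_atom_exchange\<close>). This is used in both directions.

  From \<open>G\<close> to \<open>C\<^sub>n\<close> it says that all marked atoms of \<open>G\<close> with at least four terms have odd size.
  A group with more than four elements and an involution has a marked atom of even size at least four
  (\<open>involution_imp_even_marked_atom\<close>). Now \<open>G\<close> has at least \<open>n\<close> elements, because a bound for the sizes of its atoms
  is one for those of \<open>C\<^sub>n\<close> and no atom has more terms than the group has elements. So \<open>G\<close> contains no
  involution, that is, all its elements have odd order.

  From \<open>C\<^sub>n\<close> to \<open>G\<close>, the marked atom \<open>g\<^sup>n\<close> for a generator \<open>g\<close> of \<open>C\<^sub>n\<close> gives an element of \<open>G\<close> whose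
  order \<open>p\<close> satisfies \<open>n - 2 dvd p - 2\<close>; as atoms of \<open>G\<close> have at most \<open>n\<close> terms, \<open>p = n\<close>. With \<open>g\<close> now
  this element of \<open>G\<close> and \<open>h\<close> outside the subgroup generated by \<open>g\<close>, the sequence \<open>g\<^bsup>n-1\<^esup> (g h) h\<close> would be
  an atom with \<open>n + 1\<close> terms (\<open>odd_cyclic_of_bounded_atoms\<close>). So \<open>g\<close> generates \<open>G\<close>.
\<close>

section \<open>Plus-minus weighted zero-sum sequences\<close>

text \<open>
  The operation need not commute outside the carrier, so the product runs over the distinct elements with
  powers instead of folding over the multiset.
\<close>
definition mset_prod :: "('a, 'b) monoid_scheme \<Rightarrow> 'a multiset \<Rightarrow> 'a" where
  "mset_prod G M = (\<Otimes>\<^bsub>G\<^esub>x\<in>set_mset M. x [^]\<^bsub>G\<^esub> count M x)"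

abbreviation pm_seqs :: "('a, 'b) monoid_scheme \<Rightarrow> 'a multiset set" where
  "pm_seqs G \<equiv> carrier (pm_zero_sum_monoid G)"

definition pm_atoms :: "('a, 'b) monoid_scheme \<Rightarrow> 'a multiset set" where
  "pm_atoms G = {U \<in> pm_seqs G. U \<noteq> {#} \<and>
     (\<forall>S\<in>pm_seqs G. \<forall>T\<in>pm_seqs G. U = S + T \<longrightarrow> S = {#} \<or> T = {#})}"

abbreviation pm_lengths :: "('a, 'b) monoid_scheme \<Rightarrow> 'a multiset \<Rightarrow> nat set" where
  "pm_lengths G \<equiv> set_of_lengths (pm_zero_sum_monoid G)"

context comm_group
begin

lemma mset_prod_superset:
  assumes "finite A" "set_mset M \<subseteq> A" "A \<subseteq> carrier G"
  shows "mset_prod G M = (\<Otimes>x\<in>A. x [^] count M x)"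
  unfolding mset_prod_def using assms
  by (intro finprod_mono_neutral_cong_left) (auto simp: not_in_iff)

lemma mset_prod_empty [simp]: "mset_prod G {#} = \<one>"
  by (simp add: mset_prod_def)

lemma mset_prod_closed [simp]: "set_mset M \<subseteq> carrier G \<Longrightarrow> mset_prod G M \<in> carrier G"
  unfolding mset_prod_def by (intro finprod_closed) auto

lemma mset_prod_union [simp]:
  assumes "set_mset M \<subseteq> carrier G" "set_mset N \<subseteq> carrier G"
  shows "mset_prod G (M + N) = mset_prod G M \<otimes> mset_prod G N"
proof -
  let ?A = "set_mset M \<union> set_mset N"
  have A: "finite ?A" "?A \<subseteq> carrier G" using assms by auto
  have "mset_prod G (M + N) = (\<Otimes>x\<in>?A. x [^] count (M + N) x)"
    using A by (intro mset_prod_superset) auto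
  also have "\<dots> = (\<Otimes>x\<in>?A. x [^] count M x \<otimes> x [^] count N x)"
    using A by (intro finprod_cong') (auto simp: nat_pow_mult)
  also have "\<dots> = (\<Otimes>x\<in>?A. x [^] count M x) \<otimes> (\<Otimes>x\<in>?A. x [^] count N x)"
    using A by (intro finprod_multf) auto
  finally show ?thesis
    using mset_prod_superset[OF A(1) _ A(2), of M] mset_prod_superset[OF A(1) _ A(2), of N] by simp
qed

lemma mset_prod_replicate [simp]:
  assumes "x \<in> carrier G"
  shows "mset_prod G (replicate_mset n x) = x [^] n"
proof -
  have "mset_prod G (replicate_mset n x) = (\<Otimes>y\<in>{x}. y [^] count (replicate_mset n x) y)"
    using assms by (intro mset_prod_superset) (auto split: if_splits)
  then show ?thesis using assms by simp
qed

lemma mset_prod_add_mset [simp]: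
  assumes "x \<in> carrier G" "set_mset M \<subseteq> carrier G"
  shows "mset_prod G (add_mset x M) = x \<otimes> mset_prod G M"
  using mset_prod_union[of "{#x#}" M] mset_prod_replicate[of x 1] assms by simp

text \<open>
  Collecting the terms with sign \<open>1\<close> in \<open>P\<close> and those with sign \<open>-1\<close> in \<open>N\<close> turns an indexed signed
  product into two unsigned products, which removes the listing and the signs from all later arguments.
\<close>

lemma signed_product_iff:
  assumes "set gs \<subseteq> carrier G"
  shows "(\<exists>\<epsilon>. (\<forall>i < length gs. \<epsilon> i \<in> {-1, 1}) \<and>
            (\<Otimes>i\<in>{..<length gs}. (gs ! i) [^] (\<epsilon> i :: int)) = y) \<longleftrightarrow>
         (\<exists>P N. mset gs = P + N \<and> y = mset_prod G P \<otimes> inv (mset_prod G N))"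
  (is "?A gs y \<longleftrightarrow> ?B gs y")
  using assms
proof (induction gs arbitrary: y rule: rev_induct)
  case Nil
  show ?case by auto
next
  case (snoc x gs)
  have x: "x \<in> carrier G" and gs: "set gs \<subseteq> carrier G" using snoc.prems by auto
  have step: "(\<Otimes>i\<in>{..<length (gs @ [x])}. ((gs @ [x]) ! i) [^] (\<epsilon> i :: int)) =
      x [^] \<epsilon> (length gs) \<otimes> (\<Otimes>i\<in>{..<length gs}. (gs ! i) [^] \<epsilon> i)" for \<epsilon>
  proof -
    have "(\<Otimes>i\<in>{..<length (gs @ [x])}. ((gs @ [x]) ! i) [^] (\<epsilon> i :: int)) =
      x [^] \<epsilon> (length gs) \<otimes> (\<Otimes>i\<in>{..<length gs}. ((gs @ [x]) ! i) [^] \<epsilon> i)"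
      using x gs nth_mem[of _ gs]
      by (simp add: lessThan_Suc, subst finprod_insert) (auto simp: nth_append subset_iff)
    also have "(\<Otimes>i\<in>{..<length gs}. ((gs @ [x]) ! i) [^] \<epsilon> i) =
        (\<Otimes>i\<in>{..<length gs}. (gs ! i) [^] \<epsilon> i)"
      using x gs nth_mem[of _ gs] by (intro finprod_cong') (auto simp: nth_append subset_iff)
    finally show ?thesis .
  qed
  show ?case
  proof
    assume "?A (gs @ [x]) y"
    then obtain \<epsilon> where \<epsilon>: "\<forall>i < length (gs @ [x]). \<epsilon> i \<in> {-1, 1 :: int}"
      "x [^] \<epsilon> (length gs) \<otimes> (\<Otimes>i\<in>{..<length gs}. (gs ! i) [^] \<epsilon> i) = y"
      unfolding step by blast
    have "?A gs (\<Otimes>i\<in>{..<length gs}. (gs ! i) [^] \<epsilon> i)"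
      using \<epsilon>(1) by (intro exI[of _ \<epsilon>]) auto
    then obtain P N where PN: "mset gs = P + N"
      "(\<Otimes>i\<in>{..<length gs}. (gs ! i) [^] \<epsilon> i) = mset_prod G P \<otimes> inv (mset_prod G N)"
      using snoc.IH[OF gs] by blast
    have sub: "set_mset P \<subseteq> carrier G" "set_mset N \<subseteq> carrier G"
      using gs PN(1) by (metis set_mset_mset set_mset_union le_sup_iff)+
    consider "\<epsilon> (length gs) = 1" | "\<epsilon> (length gs) = -1" using \<epsilon>(1) by auto
    then show "?B (gs @ [x]) y"
    proof cases
      case 1
      have "y = mset_prod G (add_mset x P) \<otimes> inv (mset_prod G N)"
        using \<epsilon>(2) PN(2) 1 x sub by (simp add: m_assoc int_pow_1)
      then show ?thesis using PN(1) by (intro exI[of _ "add_mset x P"] exI[of _ N]) auto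
    next
      case 2
      have "y = mset_prod G P \<otimes> inv (mset_prod G (add_mset x N))"
        using \<epsilon>(2) PN(2) 2 x sub by (simp add: m_ac inv_mult int_pow_neg int_pow_1)
      then show ?thesis using PN(1) by (intro exI[of _ P] exI[of _ "add_mset x N"]) auto
    qed
  next
    assume "?B (gs @ [x]) y"
    then obtain P N where PN: "add_mset x (mset gs) = P + N"
      "y = mset_prod G P \<otimes> inv (mset_prod G N)" by auto
    have sub: "set_mset P \<subseteq> carrier G" "set_mset N \<subseteq> carrier G"
      using x gs arg_cong[OF PN(1), of set_mset] by auto
    have extend: "?A (gs @ [x]) (x [^] d \<otimes> z)" if "?A gs z" "d \<in> {-1, 1 :: int}" for z d
    proof -
      from that obtain \<epsilon> where \<epsilon>: "\<forall>i < length gs. \<epsilon> i \<in> {-1, 1 :: int}"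
        "(\<Otimes>i\<in>{..<length gs}. (gs ! i) [^] \<epsilon> i) = z" by blast
      let ?\<epsilon> = "\<epsilon>(length gs := d)"
      have "(\<Otimes>i\<in>{..<length gs}. (gs ! i) [^] ?\<epsilon> i) = z"
        unfolding \<epsilon>(2)[symmetric] using gs nth_mem[of _ gs]
        by (intro finprod_cong') (auto simp: subset_iff)
      then show ?thesis
        unfolding step using that(2) \<epsilon>(1) by (intro exI[of _ ?\<epsilon>]) auto
    qed
    have "x \<in># P + N" using PN(1) by (metis union_single_eq_member)
    then consider "x \<in># P" | "x \<in># N" by auto
    then show "?A (gs @ [x]) y"
    proof cases
      case 1
      then obtain P' where P': "P = add_mset x P'" by (metis mset_add)
      have "?B gs (mset_prod G P' \<otimes> inv (mset_prod G N))" using PN(1) P' by auto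
      then have "?A gs (mset_prod G P' \<otimes> inv (mset_prod G N))" using snoc.IH[OF gs] by blast
      from extend[OF this, of 1] show ?thesis
        using PN(2) P' x sub by (simp add: m_assoc int_pow_1)
    next
      case 2
      then obtain N' where N': "N = add_mset x N'" by (metis mset_add)
      have "?B gs (mset_prod G P \<otimes> inv (mset_prod G N'))" using PN(1) N' by auto
      then have "?A gs (mset_prod G P \<otimes> inv (mset_prod G N'))" using snoc.IH[OF gs] by blast
      from extend[OF this, of "-1"] show ?thesis
        using PN(2) N' x sub by (simp add: m_ac inv_mult int_pow_neg int_pow_1)
    qed
  qed
qed

lemma pm_seqs_iff:
  "S \<in> pm_seqs G \<longleftrightarrow>
    set_mset S \<subseteq> carrier G \<and> (\<exists>P N. S = P + N \<and> mset_prod G P = mset_prod G N)"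
proof (cases "set_mset S \<subseteq> carrier G")
  case True
  have "pm_zero_sum G S \<longleftrightarrow> (\<exists>gs. mset gs = S \<and>
      (\<exists>P N. mset gs = P + N \<and> \<one> = mset_prod G P \<otimes> inv (mset_prod G N)))"
  proof -
    have "(\<exists>\<epsilon>. (\<forall>i < length gs. \<epsilon> i \<in> {-1, 1}) \<and>
            (\<Otimes>i\<in>{..<length gs}. (gs ! i) [^] (\<epsilon> i :: int)) = \<one>) \<longleftrightarrow>
         (\<exists>P N. mset gs = P + N \<and> \<one> = mset_prod G P \<otimes> inv (mset_prod G N))"
      if "mset gs = S" for gs
      using that True by (intro signed_product_iff) auto
    then show ?thesis unfolding pm_zero_sum_def by blast
  qed
  also have "\<dots> \<longleftrightarrow> (\<exists>P N. S = P + N \<and> \<one> = mset_prod G P \<otimes> inv (mset_prod G N))"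
    by (metis ex_mset)
  also have "\<dots> \<longleftrightarrow> (\<exists>P N. S = P + N \<and> mset_prod G P = mset_prod G N)"
  proof -
    have "\<one> = mset_prod G P \<otimes> inv (mset_prod G N) \<longleftrightarrow> mset_prod G P = mset_prod G N"
      if "S = P + N" for P N
    proof -
      have "set_mset P \<subseteq> carrier G" "set_mset N \<subseteq> carrier G" using that True by auto
      then show ?thesis
        by (metis inv_solve_right l_one mset_prod_closed one_closed r_inv)
    qed
    then show ?thesis by blast
  qed
  finally show ?thesis using True by (simp add: pm_zero_sum_monoid_def)
qed (simp add: pm_zero_sum_monoid_def)

lemma pm_seqsI:
  "set_mset P \<subseteq> carrier G \<Longrightarrow> set_mset N \<subseteq> carrier G \<Longrightarrow> mset_prod G P = mset_prod G N
    \<Longrightarrow> P + N \<in> pm_seqs G"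
  unfolding pm_seqs_iff by auto

lemma pm_seqsE:
  assumes "S \<in> pm_seqs G"
  obtains P N where "S = P + N" "set_mset P \<subseteq> carrier G" "set_mset N \<subseteq> carrier G"
    "mset_prod G P = mset_prod G N"
  using assms unfolding pm_seqs_iff by auto

lemma pm_seqs_subset: "S \<in> pm_seqs G \<Longrightarrow> set_mset S \<subseteq> carrier G"
  by (simp add: pm_seqs_iff)

lemma pm_seqs_empty [simp]: "{#} \<in> pm_seqs G"
  by (simp add: pm_seqs_iff)

lemma pm_seqs_add:
  assumes "S \<in> pm_seqs G" "T \<in> pm_seqs G"
  shows "S + T \<in> pm_seqs G"
proof -
  obtain P N where 1: "S = P + N" "set_mset P \<subseteq> carrier G" "set_mset N \<subseteq> carrier G"
    "mset_prod G P = mset_prod G N" using assms(1) by (rule pm_seqsE)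
  obtain P' N' where 2: "T = P' + N'" "set_mset P' \<subseteq> carrier G" "set_mset N' \<subseteq> carrier G"
    "mset_prod G P' = mset_prod G N'" using assms(2) by (rule pm_seqsE)
  have "(P + P') + (N + N') \<in> pm_seqs G"
    using 1 2 by (intro pm_seqsI) auto
  then show ?thesis using 1 2 by (simp add: ac_simps)
qed

lemma pm_seqs_double: "set_mset P \<subseteq> carrier G \<Longrightarrow> P + P \<in> pm_seqs G"
  by (simp add: pm_seqsI)

section \<open>Atoms and sets of lengths\<close>

lemma mult_pm [simp]: "S \<otimes>\<^bsub>pm_zero_sum_monoid G\<^esub> T = S + T"
  and one_pm [simp]: "\<one>\<^bsub>pm_zero_sum_monoid G\<^esub> = {#}"
  by (simp_all add: pm_zero_sum_monoid_def)

lemma Units_pm: "Units (pm_zero_sum_monoid G) = {{#}}"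
  by (auto simp: Units_def)

lemma irreducible_pm_iff:
  assumes "U \<in> pm_seqs G"
  shows "irreducible (pm_zero_sum_monoid G) U \<longleftrightarrow> U \<in> pm_atoms G"
proof -
  have "properfactor (pm_zero_sum_monoid G) S U \<longleftrightarrow> (\<exists>T\<in>pm_seqs G. U = S + T \<and> T \<noteq> {#})"
    if S: "S \<in> pm_seqs G" for S
  proof
    assume "properfactor (pm_zero_sum_monoid G) S U"
    then obtain T where "T \<in> pm_seqs G" "U = S + T" "\<not> U divides\<^bsub>pm_zero_sum_monoid G\<^esub> S"
      unfolding properfactor_def factor_def by auto
    moreover from this have "T \<noteq> {#}" by (auto simp: factor_def)
    ultimately show "\<exists>T\<in>pm_seqs G. U = S + T \<and> T \<noteq> {#}" by blast
  next
    assume "\<exists>T\<in>pm_seqs G. U = S + T \<and> T \<noteq> {#}"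
    then show "properfactor (pm_zero_sum_monoid G) S U"
      unfolding properfactor_def factor_def by auto
  qed
  then show ?thesis
    unfolding irreducible_def Units_pm pm_atoms_def using assms by blast
qed

lemma foldr_pm: "foldr (\<otimes>\<^bsub>pm_zero_sum_monoid G\<^esub>) us {#} = sum_list us"
  by (induction us) auto

lemma pm_atoms_subset: "pm_atoms G \<subseteq> pm_seqs G"
  by (auto simp: pm_atoms_def)

lemma pm_atomsD:
  "U \<in> pm_atoms G \<Longrightarrow> U = S + T \<Longrightarrow> S \<in> pm_seqs G \<Longrightarrow> T \<in> pm_seqs G \<Longrightarrow> S = {#} \<or> T = {#}"
  unfolding pm_atoms_def by blast

text \<open>
  The length \<open>0\<close> prescribed for the unit \<open>{#}\<close> is that of its only factorization, the empty one.
\<close>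

lemma pm_lengths_iff:
  "k \<in> pm_lengths G S \<longleftrightarrow> (\<exists>us. set us \<subseteq> pm_atoms G \<and> sum_list us = S \<and> length us = k)"
proof (cases "S = {#}")
  case True
  have "us = []" if "set us \<subseteq> pm_atoms G" "sum_list us = {#}" for us
    using that by (cases us) (auto simp: pm_atoms_def)
  then show ?thesis using True by (auto simp: set_of_lengths_def Units_pm)
next
  case False
  have "set us \<subseteq> pm_seqs G \<and> factors (pm_zero_sum_monoid G) us S \<longleftrightarrow>
      set us \<subseteq> pm_atoms G \<and> sum_list us = S" for us
    using irreducible_pm_iff pm_atoms_subset by (fastforce simp: factors_def foldr_pm)
  then show ?thesis using False by (auto simp: set_of_lengths_def Units_pm)
qed

lemma pm_lengthsI: "set us \<subseteq> pm_atoms G \<Longrightarrow> length us \<in> pm_lengths G (sum_list us)"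
  unfolding pm_lengths_iff by blast

lemma pm_lengths_nonempty:
  assumes "S \<in> pm_seqs G"
  shows "\<exists>k. k \<in> pm_lengths G S"
  using assms
proof (induction "size S" arbitrary: S rule: less_induct)
  case less
  show ?case
  proof (cases "S = {#} \<or> S \<in> pm_atoms G")
    case True
    then show ?thesis using pm_lengthsI[of "[]"] pm_lengthsI[of "[S]"] by auto
  next
    case False
    then obtain T R where TR: "T \<in> pm_seqs G" "R \<in> pm_seqs G" "S = T + R" "T \<noteq> {#}" "R \<noteq> {#}"
      using less.prems unfolding pm_atoms_def by blast
    have "size T < size S" "size R < size S"
      using TR(3-5) by (auto simp: nonempty_has_size)
    then obtain us vs where "set us \<subseteq> pm_atoms G" "sum_list us = T" "set vs \<subseteq> pm_atoms G" "sum_list vs = R"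
      using less.hyps[of T] less.hyps[of R] TR unfolding pm_lengths_iff by blast
    then have "length (us @ vs) \<in> pm_lengths G S" using TR(3) pm_lengthsI[of "us @ vs"] by auto
    then show ?thesis by blast
  qed
qed

lemma pm_lengths_add:
  assumes "k \<in> pm_lengths G S" "l \<in> pm_lengths G T"
  shows "k + l \<in> pm_lengths G (S + T)"
proof -
  obtain us vs where "set us \<subseteq> pm_atoms G" "sum_list us = S" "length us = k"
    "set vs \<subseteq> pm_atoms G" "sum_list vs = T" "length vs = l"
    using assms unfolding pm_lengths_iff by blast
  then show ?thesis using pm_lengthsI[of "us @ vs"] by auto
qed

end

section \<open>Sizes of atoms and ranges of lengths\<close>

lemma replicate_mset_add: "replicate_mset (m + n) x = replicate_mset m x + replicate_mset n x"
  by (induction m) auto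

context comm_group
begin

lemma nat_pow_eq_iff:
  assumes "x \<in> carrier G"
  shows "x [^] (i::nat) = x [^] (j::nat) \<longleftrightarrow> int (ord x) dvd int i - int j"
  using int_pow_eq[OF assms, of "int j" "int i"] by (auto simp: int_pow_int)

lemma singleton_pm_seqs_iff: "{#g#} \<in> pm_seqs G \<longleftrightarrow> g = \<one>"
proof
  assume "{#g#} \<in> pm_seqs G"
  then obtain P N where PN: "{#g#} = P + N" "set_mset P \<subseteq> carrier G" "set_mset N \<subseteq> carrier G"
    "mset_prod G P = mset_prod G N" by (rule pm_seqsE)
  then consider "P = {#g#}" "N = {#}" | "P = {#}" "N = {#g#}"
    by (metis union_is_single)
  then show "g = \<one>" using PN by cases (auto simp: mset_prod_replicate[of g 1, simplified])
next
  assume "g = \<one>"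
  then show "{#g#} \<in> pm_seqs G"
    using pm_seqsI[of "{#\<one>#}" "{#}"] by simp
qed

lemma atom_pair:
  assumes "g \<in> carrier G" "g \<noteq> \<one>"
  shows "{#g, g#} \<in> pm_atoms G"
  unfolding pm_atoms_def
proof (intro CollectI conjI ballI impI)
  show "{#g, g#} \<in> pm_seqs G" using pm_seqs_double[of "{#g#}"] assms by simp
  fix S T assume ST: "S \<in> pm_seqs G" "T \<in> pm_seqs G" "{#g, g#} = S + T"
  show "S = {#} \<or> T = {#}"
  proof (rule ccontr)
    assume "\<not> (S = {#} \<or> T = {#})"
    moreover have "size S + size T = 2" using arg_cong[OF ST(3), of size] by simp
    ultimately have "size S = 1" by (auto simp: nonempty_has_size)
    then obtain x where "S = {#x#}" using size_1_singleton_mset by blast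
    moreover from this have "x \<in># {#g, g#}" unfolding ST(3) by simp
    ultimately show False using ST(1) assms(2) by (simp add: singleton_pm_seqs_iff)
  qed
qed simp

text \<open>
  The way atoms get identified below: a nonempty zero-sum part with zero-sum complement is everything.
\<close>

lemma atom_eqI:
  assumes "U \<in> pm_atoms G" "S \<subseteq># U" "S \<noteq> {#}" "S \<in> pm_seqs G" "U - S \<in> pm_seqs G"
  shows "U = S"
proof -
  have U: "U = S + (U - S)" using assms(2) by simp
  show ?thesis using pm_atomsD[OF assms(1) U assms(4,5)] assms(3) U by auto
qed

text \<open>
  The identity may always be deleted from a zero-sum sequence, so it is a prime element of the monoid.
\<close>

lemma atom_cases:
  assumes "U \<in> pm_atoms G"
  shows "U = {#\<one>#} \<or> \<one> \<notin># U \<and> 2 \<le> size U"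
proof (cases "\<one> \<in># U")
  case True
  have U: "U \<in> pm_seqs G" using assms pm_atoms_subset by blast
  then obtain P N where PN: "U = P + N" "set_mset P \<subseteq> carrier G" "set_mset N \<subseteq> carrier G"
    "mset_prod G P = mset_prod G N" by (rule pm_seqsE)
  have "U - {#\<one>#} \<in> pm_seqs G"
  proof (cases "\<one> \<in># P")
    case True
    then obtain P' where "P = add_mset \<one> P'" by (metis mset_add)
    then show ?thesis using PN pm_seqsI[of P' N] by simp
  next
    case False
    then obtain N' where "N = add_mset \<one> N'" using True PN(1) by (metis mset_add union_iff)
    then show ?thesis using PN pm_seqsI[of P N'] by simp
  qed
  then show ?thesis
    using atom_eqI[OF assms, of "{#\<one>#}"] True singleton_pm_seqs_iff[of \<one>] by auto
next
  case False
  have U: "U \<in> pm_seqs G" "U \<noteq> {#}" using assms by (auto simp: pm_atoms_def)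
  have "size U \<noteq> 1"
  proof
    assume "size U = 1"
    then obtain g where "U = {#g#}" using size_1_singleton_mset by blast
    then show False using U(1) False by (simp add: singleton_pm_seqs_iff)
  qed
  moreover have "size U \<noteq> 0" using U(2) by simp
  ultimately show ?thesis using False by linarith
qed

text \<open>
  This is the classical bound for the Davenport constant. A signed zero-sum sequence with more than
  \<open>|G|\<close> terms has two equal partial products among the first \<open>|G| + 1\<close> ones, the empty product included;
  the block between them is zero-sum, nonempty and proper, and its complement is zero-sum as well.
\<close>

lemma atom_size_le_order:
  assumes fin: "finite (carrier G)" and U: "U \<in> pm_atoms G"
  shows "size U \<le> card (carrier G)"
proof (rule ccontr)
  assume "\<not> ?thesis"
  then have large: "card (carrier G) < size U" by simp
  have "U \<in> pm_seqs G" using U pm_atoms_subset by blast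
  then obtain P N where PN: "U = P + N" "set_mset P \<subseteq> carrier G" "set_mset N \<subseteq> carrier G"
    "mset_prod G P = mset_prod G N" by (rule pm_seqsE)
  obtain xs ys where xs: "mset xs = P" and ys: "mset ys = N" by (metis ex_mset)
  have xc: "set xs \<subseteq> carrier G" and yc: "set ys \<subseteq> carrier G" using xs ys PN by auto
  \<comment> \<open>The partial products run through \<open>P\<close> first and then, with inverted factors, through \<open>N\<close>.\<close>
  define f where "f i = mset_prod G (mset (take i xs)) \<otimes>
      inv (mset_prod G (mset (take (i - length xs) ys)))" for i
  have sub: "set (take i xs) \<subseteq> carrier G" "set (drop i xs) \<subseteq> carrier G"
    "set (take i ys) \<subseteq> carrier G" "set (drop i ys) \<subseteq> carrier G" for i
    using xc yc set_take_subset[of i xs] set_drop_subset[of i xs]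
      set_take_subset[of i ys] set_drop_subset[of i ys] by blast+
  have "f ` {..card (carrier G)} \<subseteq> carrier G" using sub by (auto simp: f_def)
  then have "card (f ` {..card (carrier G)}) < card {..card (carrier G)}"
    using card_mono[OF fin, of "f ` {..card (carrier G)}"] by simp
  then have "\<not> inj_on f {..card (carrier G)}" using card_image by fastforce
  then obtain i j where ij: "i < j" "j \<le> card (carrier G)" "f i = f j"
    unfolding inj_on_def by (metis atMost_iff linorder_neqE_nat)
  define i' j' where "i' = i - length xs" and "j' = j - length xs"
  define A A' A'' where "A = mset (take i xs)" and "A' = mset (drop i (take j xs))"
    and "A'' = mset (drop j xs)"
  define B B' B'' where "B = mset (take i' ys)" and "B' = mset (drop i' (take j' ys))"
    and "B'' = mset (drop j' ys)"
  have tj: "take j zs = take i zs @ drop i (take j zs)" if "i \<le> j" for i j :: nat and zs :: "'a list"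
    using that by (metis append_take_drop_id min.absorb1 take_take)
  have AA: "mset (take j xs) = A + A'"
    unfolding A_def A'_def using tj[of i j xs] ij(1) by (metis less_imp_le mset_append)
  have BB: "mset (take j' ys) = B + B'"
    unfolding B_def B'_def using tj[of i' j' ys] ij(1)
    by (metis diff_le_mono i'_def j'_def less_imp_le mset_append)
  have P: "P = A + A' + A''" using AA unfolding xs[symmetric] A''_def
    by (metis append_take_drop_id mset_append)
  have N: "N = B + B' + B''" using BB unfolding ys[symmetric] B''_def
    by (metis append_take_drop_id mset_append)
  have car: "set_mset A \<subseteq> carrier G" "set_mset A' \<subseteq> carrier G" "set_mset A'' \<subseteq> carrier G"
    "set_mset B \<subseteq> carrier G" "set_mset B' \<subseteq> carrier G" "set_mset B'' \<subseteq> carrier G"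
    using PN(2,3) unfolding P N by auto
  let ?p = "mset_prod G"
  have "?p A \<otimes> inv (?p B) = ?p (A + A') \<otimes> inv (?p (B + B'))"
    using ij(3) AA BB unfolding f_def A_def B_def i'_def j'_def by simp
  then have eq': "?p A' = ?p B'"
  proof -
    assume h: "?p A \<otimes> inv (?p B) = ?p (A + A') \<otimes> inv (?p (B + B'))"
    have "?p (A + A') \<otimes> inv (?p (B + B')) = (?p A \<otimes> inv (?p B)) \<otimes> (?p A' \<otimes> inv (?p B'))"
      using car by (simp add: inv_mult m_ac)
    then have "?p A' \<otimes> inv (?p B') = \<one>"
      using h car by (metis inv_closed l_cancel_one' m_closed mset_prod_closed)
    then show ?thesis using car
      by (metis inv_closed inv_equality inv_inv mset_prod_closed)
  qed
  have "?p A' \<otimes> (?p A \<otimes> ?p A'') = ?p B' \<otimes> (?p B \<otimes> ?p B'')"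
    using PN(4) car unfolding P N by (simp add: m_ac)
  then have "?p A \<otimes> ?p A'' = ?p B \<otimes> ?p B''"
    using eq' car by (metis l_cancel m_closed mset_prod_closed)
  then have rest: "(A + A'') + (B + B'') \<in> pm_seqs G"
    using car by (intro pm_seqsI) auto
  have block: "A' + B' \<in> pm_seqs G" using eq' car by (intro pm_seqsI) auto
  have "U = (A' + B') + ((A + A'') + (B + B''))" unfolding PN(1) P N by (simp add: ac_simps)
  then have "A' + B' = {#} \<or> (A + A'') + (B + B'') = {#}"
    using pm_atomsD[OF U _ block rest] by blast
  moreover have "size (A' + B') = j - i"
  proof -
    have "size U = length xs + length ys" using PN(1) xs ys by auto
    then have "j \<le> length xs + length ys" using ij(2) large by simp
    then show ?thesis using ij(1) unfolding A'_def B'_def i'_def j'_def by auto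
  qed
  moreover have "size (A' + B') + size ((A + A'') + (B + B'')) = size U"
    unfolding PN(1) P N by simp
  ultimately show False using ij large by (metis add.right_neutral diff_le_self le_trans
      less_irrefl not_less size_empty zero_less_diff)
qed

text \<open>
  Give each term weight \<open>1\<close>, but the identity weight \<open>2\<close>. Then every atom has weight at least \<open>2\<close>,
  and at most \<open>m\<close> if \<open>m \<ge> 2\<close> bounds the sizes of the atoms. Moreover each atom contains the identity at most once.
\<close>

lemma length_bounds:
  assumes "k \<in> pm_lengths G S"
  shows "2 * k \<le> size S + count S \<one>" "count S \<one> \<le> k"
    "(\<And>U. U \<in> pm_atoms G \<Longrightarrow> size U \<le> m) \<Longrightarrow> 2 \<le> m \<Longrightarrow> size S + count S \<one> \<le> m * k"
proof -
  obtain us where us: "set us \<subseteq> pm_atoms G" "sum_list us = S" "length us = k"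
    using assms unfolding pm_lengths_iff by blast
  have "2 * length us \<le> size (sum_list us) + count (sum_list us) \<one>
      \<and> count (sum_list us) \<one> \<le> length us"
    using us(1)
  proof (induction us)
    case (Cons U us)
    then show ?case using atom_cases[of U] by (auto simp: not_in_iff)
  qed simp
  then show "2 * k \<le> size S + count S \<one>" "count S \<one> \<le> k" using us by auto
  assume m: "\<And>U. U \<in> pm_atoms G \<Longrightarrow> size U \<le> m" "2 \<le> m"
  have "size (sum_list us) + count (sum_list us) \<one> \<le> m * length us"
    using us(1)
  proof (induction us)
    case (Cons U us)
    have "size U + count U \<one> \<le> m"
      using atom_cases[of U] Cons.prems m(1)[of U] m(2) by (auto simp: not_in_iff)
    then show ?case using Cons by simp
  qed simp
  then show "size S + count S \<one> \<le> m * k" using us by simp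
qed

text \<open>
  A factorization of length \<open>a\<close> allows at most \<open>a\<close> copies of the identity, so the existence of
  a much longer factorization forces many other terms; one of these must be frequent.
\<close>

lemma frequent_element:
  assumes fin: "finite (carrier G)"
    and S: "S \<in> pm_seqs G" "a \<in> pm_lengths G S" "b \<in> pm_lengths G S"
    and long: "3 * card (carrier G) ^ 2 + 2 * a \<le> 2 * b"
  obtains g where "g \<in> carrier G" "g \<noteq> \<one>" "3 * card (carrier G) \<le> count S g"
proof -
  let ?n = "card (carrier G)"
  have "\<exists>g\<in>carrier G. g \<noteq> \<one> \<and> 3 * ?n \<le> count S g"
  proof (rule ccontr)
    assume neg: "\<not> ?thesis"
    have "size S = (\<Sum>x\<in>carrier G. count S x)"
      unfolding size_multiset_overloaded_eq using fin pm_seqs_subset[OF S(1)]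
      by (intro sum.mono_neutral_left) (auto simp: not_in_iff)
    also have "\<dots> = count S \<one> + (\<Sum>x\<in>carrier G - {\<one>}. count S x)"
      using fin by (intro sum.remove) auto
    also have "(\<Sum>x\<in>carrier G - {\<one>}. count S x) \<le> of_nat (card (carrier G - {\<one>})) * (3 * ?n)"
      using neg by (intro sum_bounded_above) (auto simp: not_le intro: less_imp_le)
    also have "\<dots> < 3 * ?n ^ 2"
    proof -
      have "?n > 0" using fin by (auto simp: card_gt_0_iff)
      then show ?thesis using fin by (simp add: power2_eq_square)
    qed
    finally have "size S < count S \<one> + 3 * ?n ^ 2" by simp
    then show False
      using length_bounds(1)[OF S(3)] length_bounds(2)[OF S(2)] long by linarith
  qed
  then show thesis using that by blast
qed

section \<open>Elements of odd order\<close>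

lemma odd_replicate_pm_seqs:
  assumes g: "g \<in> carrier G" and "odd A" "replicate_mset A g \<in> pm_seqs G"
  shows "ord g \<le> A"
proof -
  obtain P N where PN: "replicate_mset A g = P + N" "mset_prod G P = mset_prod G N"
    using assms(3) by (rule pm_seqsE)
  obtain i j where "P = replicate_mset i g" "N = replicate_mset j g"
    using PN(1) by (metis mset_subset_eq_add_left mset_subset_eq_add_right msubseteq_replicate_msetE)
  then have ij: "A = i + j" "int (ord g) dvd int i - int j"
    using arg_cong[OF PN(1), of size] PN(2) g by (auto simp: nat_pow_eq_iff)
  have "int i - int j \<noteq> 0" using ij(1) \<open>odd A\<close> by auto
  then have "int (ord g) \<le> \<bar>int i - int j\<bar>" using ij(2) by (simp add: zdvd_imp_le dvd_abs_iff)
  then show ?thesis using ij(1) by linarith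
qed

text \<open>
  A proper splitting of \<open>g\<^sup>p\<close> with \<open>p\<close> odd has a part with an odd number of terms less than \<open>p\<close>. Its signed
  number of terms is odd and less than \<open>p\<close> in absolute value, hence nonzero modulo \<open>p\<close>.
\<close>

lemma atom_odd_power:
  assumes g: "g \<in> carrier G" and "odd (ord g)"
  shows "replicate_mset (ord g) g \<in> pm_atoms G"
  unfolding pm_atoms_def
proof (intro CollectI conjI ballI impI)
  show "replicate_mset (ord g) g \<in> pm_seqs G"
    using pm_seqsI[of "replicate_mset (ord g) g" "{#}"] g by simp
  show "replicate_mset (ord g) g \<noteq> {#}" using \<open>odd (ord g)\<close> by (cases "ord g") auto
  fix S T assume ST: "S \<in> pm_seqs G" "T \<in> pm_seqs G" "replicate_mset (ord g) g = S + T"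
  obtain a b where ab: "S = replicate_mset a g" "T = replicate_mset b g"
    using ST(3) by (metis mset_subset_eq_add_left mset_subset_eq_add_right msubseteq_replicate_msetE)
  have sum: "ord g = a + b" using arg_cong[OF ST(3), of size] ab by simp
  then have "odd a \<or> odd b" using \<open>odd (ord g)\<close> by auto
  then show "S = {#} \<or> T = {#}"
    using odd_replicate_pm_seqs[OF g] ST ab sum by force
qed

text \<open>
  The complement of a zero-sum part need not be zero-sum, which is why \<open>3 p\<close> copies are required
  to remove \<open>2 p\<close> of them: then \<open>2 p\<close> copies carry the same sign or there are \<open>p\<close> of either sign,
  and both kinds of removal preserve the signed product.
\<close>

lemma remove_powers_pm_seqs:
  assumes g: "g \<in> carrier G" "g [^] p = \<one>" and S: "S \<in> pm_seqs G" "3 * p \<le> count S g"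
  shows "S - replicate_mset (2 * p) g \<in> pm_seqs G"
proof -
  obtain P N where PN: "S = P + N" "set_mset P \<subseteq> carrier G" "set_mset N \<subseteq> carrier G"
    "mset_prod G P = mset_prod G N" using S(1) by (rule pm_seqsE)
  have key: "S - replicate_mset (2 * p) g \<in> pm_seqs G"
    if "a + b = 2 * p" "a \<le> count P g" "b \<le> count N g" "g [^] a = g [^] b" for a b
  proof -
    define P' N' where "P' = P - replicate_mset a g" and "N' = N - replicate_mset b g"
    have P': "P = replicate_mset a g + P'" and N': "N = replicate_mset b g + N'"
      using that by (simp_all add: P'_def N'_def count_le_replicate_mset_subset_eq)
    have sub: "set_mset P' \<subseteq> carrier G" "set_mset N' \<subseteq> carrier G" using PN(2,3) P' N' by auto
    have "set_mset (replicate_mset a g) \<subseteq> carrier G" "set_mset (replicate_mset b g) \<subseteq> carrier G"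
      using g by (auto simp: set_mset_replicate_mset_subset)
    then have "g [^] a \<otimes> mset_prod G P' = g [^] b \<otimes> mset_prod G N'"
      using PN(4) sub g unfolding P' N' by simp
    then have "mset_prod G P' = mset_prod G N'" using that(4) sub g by simp
    then have "P' + N' \<in> pm_seqs G" using sub by (intro pm_seqsI)
    moreover have "S = replicate_mset (2 * p) g + (P' + N')"
      unfolding PN(1) that(1)[symmetric] replicate_mset_add
      by (subst P', subst N') (simp add: ac_simps)
    ultimately show ?thesis by simp
  qed
  have two: "g [^] (2 * p) = \<one>"
    using g by (simp add: mult_2 flip: nat_pow_mult)
  have "3 * p \<le> count P g + count N g" using S(2) PN(1) by simp
  then consider "2 * p \<le> count P g" | "2 * p \<le> count N g" | "p \<le> count P g" "p \<le> count N g"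
    by linarith
  then show ?thesis
    using key[of "2 * p" 0] key[of 0 "2 * p"] key[of p p] two by cases auto
qed

text \<open>
  The two lengths come from \<open>g\<^bsup>2p\<^esup> = g\<^sup>p g\<^sup>p = (g g)\<^sup>p\<close>, times a common factorization of the rest.
\<close>

lemma odd_order_exchange:
  assumes g: "g \<in> carrier G" "g \<noteq> \<one>" "odd (ord g)"
    and S: "S \<in> pm_seqs G" "3 * ord g \<le> count S g"
  obtains l where "l + 2 \<in> pm_lengths G S" "l + ord g \<in> pm_lengths G S"
proof -
  let ?p = "ord g"
  let ?R = "S - replicate_mset (2 * ?p) g"
  have "?R \<in> pm_seqs G" using remove_powers_pm_seqs g S by simp
  then obtain l where l: "l \<in> pm_lengths G ?R" using pm_lengths_nonempty by blast
  have split: "?R + replicate_mset (2 * ?p) g = S"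
    using S(2) by (intro subset_mset.diff_add) (simp flip: count_le_replicate_mset_subset_eq)
  have "2 \<in> pm_lengths G (replicate_mset (2 * ?p) g)"
    using pm_lengthsI[of "[replicate_mset ?p g, replicate_mset ?p g]"] atom_odd_power g
    by (simp add: mult_2 replicate_mset_add numeral_2_eq_2)
  moreover have "?p \<in> pm_lengths G (replicate_mset (2 * ?p) g)"
  proof -
    have "sum_list (replicate m {#g, g#}) = replicate_mset (2 * m) g" for m
      by (induction m) auto
    then show ?thesis
      using pm_lengthsI[of "replicate ?p {#g, g#}"] atom_pair[OF g(1,2)]
      by (simp add: set_replicate_conv_if)
  qed
  ultimately show thesis
    using pm_lengths_add[OF l] split that by metis
qed

end

section \<open>Marked atoms\<close>

text \<open>
  The marker \<open>e\<close> fixes the parity of the number of atoms of size \<open>|V|\<close> in a factorization of a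
  given sequence. Without it this number could change by one, and lengths would only be determined
  modulo half of \<open>|V| - 2\<close> when \<open>|V|\<close> is even.
\<close>
definition marked_atom :: "('a, 'b) monoid_scheme \<Rightarrow> 'a multiset \<Rightarrow> 'a \<Rightarrow> bool" where
  "marked_atom G V e \<longleftrightarrow> V \<in> pm_atoms G \<and> \<one>\<^bsub>G\<^esub> \<notin># V \<and>
    (\<forall>W\<in>pm_atoms G. set_mset W \<subseteq> set_mset V \<longrightarrow>
      size W = 2 \<and> even (count W e) \<or> size W = size V \<and> odd (count W e))"

lemma nat_two_power_times_odd:
  assumes "0 < (q::nat)"
  obtains k m where "q = 2 ^ k * m" "odd m"
proof -
  have "\<exists>k m. q = 2 ^ k * m \<and> odd m"
    using assms
  proof (induction q rule: less_induct)
    case (less q)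
    show ?case
    proof (cases "odd q")
      case True
      then show ?thesis by (intro exI[of _ 0] exI[of _ q]) auto
    next
      case False
      then obtain r where r: "q = 2 * r" by blast
      then obtain k m where "r = 2 ^ k * m" "odd m" using less.IH[of r] less.prems by auto
      then show ?thesis using r by (intro exI[of _ "Suc k"] exI[of _ m]) auto
    qed
  qed
  then show thesis using that by blast
qed

lemma even_nonzero_ge_2: "even m \<Longrightarrow> m \<noteq> 0 \<Longrightarrow> 2 \<le> (m::nat)"
  by presburger

lemma dvd_four_not_dvd_two:
  assumes "(m::nat) dvd 4" "\<not> m dvd 2"
  shows "m = 4"
proof -
  have "m \<le> 4" using assms(1) by (auto dest: dvd_imp_le)
  then have "m = 0 \<or> m = 1 \<or> m = 2 \<or> m = 3 \<or> m = 4" by linarith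
  then show ?thesis using assms by auto
qed

lemma set_mset_repeat_mset_subset: "set_mset (repeat_mset k V) \<subseteq> set_mset V"
  by (induction k) auto

lemma three_distinct_subseteq:
  "distinct [a, b, c] \<Longrightarrow> 2 \<le> count W a \<Longrightarrow> b \<in># W \<Longrightarrow> c \<in># W \<Longrightarrow> {#a, a, b, c#} \<subseteq># W"
  by (auto simp: subseteq_mset_def)

lemma four_distinct_subseteq:
  "distinct [a, b, c, d] \<Longrightarrow> a \<in># W \<Longrightarrow> b \<in># W \<Longrightarrow> c \<in># W \<Longrightarrow> d \<in># W \<Longrightarrow> {#a, b, c, d#} \<subseteq># W"
  by (auto simp: subseteq_mset_def)

context comm_group
begin

lemma pm_lengths_repeat: "k \<in> pm_lengths G S \<Longrightarrow> m * k \<in> pm_lengths G (repeat_mset m S)"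
  using pm_lengthsI[of "[]"] by (induction m) (auto intro: pm_lengths_add)

text \<open>
  Only pairs \<open>x x\<close> are used; they are atoms because \<open>x \<noteq> \<one>\<close>.
\<close>

lemma pm_lengths_double:
  assumes "set_mset V \<subseteq> carrier G" "\<one> \<notin># V"
  shows "size V \<in> pm_lengths G (V + V)"
  using assms
proof (induction V)
  case empty
  show ?case using pm_lengthsI[of "[]"] by simp
next
  case (add x V)
  then have "{#x, x#} \<in> pm_atoms G" by (intro atom_pair) auto
  then have "1 \<in> pm_lengths G {#x, x#}" using pm_lengthsI[of "[{#x, x#}]"] by simp
  from pm_lengths_add[OF this, of "size V" "V + V"] show ?case using add by simp
qed

text \<open>
  In a factorization of length \<open>l\<close> with \<open>y\<close> atoms of size \<open>|V|\<close>, counting terms gives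
  \<open>2 l + y (|V| - 2) = 2 k |V|\<close>, and \<open>y\<close> is even because the marker occurs an even number of times in total.
\<close>

lemma marked_atom_lengths:
  assumes V: "marked_atom G V e"
  defines "S \<equiv> \<lambda>k. repeat_mset k (V + V)"
  shows "S k \<in> pm_seqs G" "2 * k \<in> pm_lengths G (S k)" "k * size V \<in> pm_lengths G (S k)"
    "l \<in> pm_lengths G (S k) \<Longrightarrow> \<exists>j. l + j * (size V - 2) = k * size V"
proof -
  have at: "V \<in> pm_atoms G" "\<one> \<notin># V" using V by (auto simp: marked_atom_def)
  have car: "set_mset V \<subseteq> carrier G" using at(1) pm_atoms_subset pm_seqs_subset by blast
  have "set_mset (repeat_mset k V) \<subseteq> carrier G"
    by (rule subset_trans[OF set_mset_repeat_mset_subset car])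
  from pm_seqs_double[OF this] show "S k \<in> pm_seqs G" by (simp add: S_def repeat_mset_distrib2)
  have "2 \<in> pm_lengths G (V + V)"
    using pm_lengthsI[of "[V, V]"] at(1) by (simp add: numeral_2_eq_2)
  from pm_lengths_repeat[OF this, of k] show "2 * k \<in> pm_lengths G (S k)"
    by (simp add: S_def mult.commute)
  show "k * size V \<in> pm_lengths G (S k)"
    unfolding S_def using pm_lengths_double[OF car at(2)] by (rule pm_lengths_repeat)
  assume "l \<in> pm_lengths G (S k)"
  then obtain us where us: "set us \<subseteq> pm_atoms G" "sum_list us = S k" "length us = l"
    unfolding pm_lengths_iff by blast
  have sub: "set_mset U \<subseteq> set_mset V" if "U \<in> set us" for U
  proof -
    have "U \<subseteq># sum_list us" using that by (induction us) (auto intro: subset_mset.add_increasing subset_mset.add_increasing2)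
    then have "set_mset U \<subseteq> set_mset (S k)" using us(2) set_mset_mono by fastforce
    then show ?thesis using set_mset_repeat_mset_subset[of k "V + V"] unfolding S_def by auto
  qed
  have V2: "2 \<le> size V" using atom_cases[OF at(1)] at(2) by auto
  have "\<exists>y. 2 * length us + y * (size V - 2) = size (sum_list us) \<and>
      (even y \<longleftrightarrow> even (count (sum_list us) e))"
    using us(1) sub
  proof (induction us)
    case (Cons U us)
    then obtain y where y: "2 * length us + y * (size V - 2) = size (sum_list us)"
      "even y \<longleftrightarrow> even (count (sum_list us) e)" by auto
    have "U \<in> pm_atoms G" "set_mset U \<subseteq> set_mset V" using Cons.prems by auto
    then consider "size U = 2" "even (count U e)" | "size U = size V" "odd (count U e)"
      using V unfolding marked_atom_def by blast
    then show ?case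
    proof cases
      case 1
      then show ?thesis using y by (intro exI[of _ y]) auto
    next
      case 2
      then show ?thesis using y V2 by (intro exI[of _ "Suc y"]) auto
    qed
  qed auto
  then obtain y where y: "2 * l + y * (size V - 2) = size (S k)" "even y \<longleftrightarrow> even (count (S k) e)"
    using us by auto
  have "even y" using y(2) by (simp add: S_def)
  then obtain j where "y = 2 * j" by blast
  then show "\<exists>j. l + j * (size V - 2) = k * size V"
    using y(1) by (intro exI[of _ j]) (simp add: S_def)
qed

lemma even_counts_pm_seqs:
  assumes "set_mset W \<subseteq> carrier G" "\<And>x. even (count W x)"
  shows "W \<in> pm_seqs G"
  using assms
proof (induction "size W" arbitrary: W rule: less_induct)
  case less
  show ?case
  proof (cases "W = {#}")
    case False
    then obtain x where x: "x \<in># W" by blast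
    have "2 \<le> count W x" using less.prems(2)[of x] x
      by (intro even_nonzero_ge_2) auto
    then have W: "W = {#x, x#} + (W - {#x, x#})"
      by (intro subset_mset.add_diff_inverse[symmetric]) (auto simp: subseteq_mset_def)
    have "size (W - {#x, x#}) < size W" using arg_cong[OF W, of size] by simp
    moreover have "set_mset (W - {#x, x#}) \<subseteq> carrier G"
      using less.prems(1) by (meson in_diffD subset_iff)
    moreover have "even (count (W - {#x, x#}) y)" for y
      using less.prems(2)[of y] by auto
    ultimately have "W - {#x, x#} \<in> pm_seqs G" using less.hyps by blast
    moreover have "{#x, x#} \<in> pm_seqs G" using pm_seqs_double[of "{#x#}"] x less.prems(1) by auto
    ultimately show ?thesis using W pm_seqs_add by metis
  qed simp
qed

text \<open>
  Sequences in which all multiplicities are even are zero-sum for trivial reasons. So it suffices to control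
  zero-sum sequences modulo such sequences: each either has even multiplicities or contains a
  zero-sum \<open>V'\<close> of size \<open>|V|\<close> with an odd number of markers whose complement has even multiplicities.
\<close>

lemma marked_atomI:
  assumes V: "V \<in> pm_seqs G" "\<one> \<notin># V" "odd (count V e)"
    and crit: "\<And>W. W \<in> pm_seqs G \<Longrightarrow> set_mset W \<subseteq> set_mset V \<Longrightarrow>
      (\<forall>x\<in>set_mset V. even (count W x)) \<or>
      (\<exists>V'\<in>pm_seqs G. V' \<subseteq># W \<and> size V' = size V \<and> odd (count V' e) \<and>
          (\<forall>x\<in>set_mset V. even (count W x - count V' x)))"
  shows "marked_atom G V e"
proof -
  have e: "e \<in># V" using V(3) by (metis count_inI even_zero)
  have car: "set_mset V \<subseteq> carrier G" using V(1) by (rule pm_seqs_subset)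
  have big: "size V \<le> size S" if "S \<in> pm_seqs G" "S \<subseteq># V" "odd (count S e)" for S
    using crit[OF that(1) set_mset_mono[OF that(2)]] that(3) e size_mset_mono by metis
  have atom: "V \<in> pm_atoms G"
    unfolding pm_atoms_def
  proof (intro CollectI conjI ballI impI)
    show "V \<in> pm_seqs G" "V \<noteq> {#}" using V(1) e by auto
    fix S T assume ST: "S \<in> pm_seqs G" "T \<in> pm_seqs G" "V = S + T"
    have "S \<subseteq># V" "T \<subseteq># V" using ST(3) by simp_all
    moreover have "odd (count S e) \<or> odd (count T e)" using V(3) ST(3) by simp
    ultimately have "size V \<le> size S \<or> size V \<le> size T" using big[OF ST(1)] big[OF ST(2)] by blast
    moreover have "size V = size S + size T" using ST(3) by simp
    ultimately show "S = {#} \<or> T = {#}" by auto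
  qed
  have "size W = 2 \<and> even (count W e) \<or> size W = size V \<and> odd (count W e)"
    if W: "W \<in> pm_atoms G" "set_mset W \<subseteq> set_mset V" for W
  proof -
    have Ws: "W \<in> pm_seqs G" "W \<noteq> {#}" using W(1) by (auto simp: pm_atoms_def)
    from crit[OF Ws(1) W(2)] show ?thesis
    proof (elim disjE bexE conjE)
      assume even: "\<forall>x\<in>set_mset V. even (count W x)"
      have ev: "even (count W x)" for x
        using even W(2) by (metis count_inI even_zero subsetD)
      obtain x where x: "x \<in># W" using Ws(2) by blast
      have "2 \<le> count W x" using ev[of x] x by (intro even_nonzero_ge_2) auto
      then have sub: "{#x, x#} \<subseteq># W" by (auto simp: subseteq_mset_def)
      have "{#x, x#} \<in> pm_seqs G" using pm_seqs_double[of "{#x#}"] x W(2) car by auto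
      moreover have "W - {#x, x#} \<in> pm_seqs G"
        using ev W(2) car by (intro even_counts_pm_seqs) (auto dest: in_diffD)
      ultimately have "W = {#x, x#}" using atom_eqI[OF W(1) sub] by simp
      then show ?thesis by auto
    next
      fix V' assume V': "V' \<in> pm_seqs G" "V' \<subseteq># W" "size V' = size V" "odd (count V' e)"
        "\<forall>x\<in>set_mset V. even (count W x - count V' x)"
      have "even (count (W - V') x)" for x
        using V'(5) W(2) by (metis count_diff count_inI diff_0_eq_0 even_zero subsetD)
      then have "W - V' \<in> pm_seqs G"
        using W(2) car by (intro even_counts_pm_seqs) (auto dest: in_diffD)
      moreover have "V' \<noteq> {#}" using V'(4) by auto
      ultimately have "W = V'" using atom_eqI[OF W(1) V'(2) _ V'(1)] by simp
      then show ?thesis using V' by auto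
    qed
  qed
  then show ?thesis unfolding marked_atom_def using atom V(2) by blast
qed

section \<open>Even marked atoms in groups with an involution\<close>

lemma mset_prod_cyclic_pair:
  assumes "x \<in> carrier G" "x [^] t \<noteq> x" "set_mset P \<subseteq> {x, x [^] t}"
  shows "mset_prod G P = x [^] (count P x + (t::nat) * count P (x [^] t))"
proof -
  have "mset_prod G P = (\<Otimes>y\<in>{x, x [^] t}. y [^] count P y)"
    using assms by (intro mset_prod_superset) auto
  then show ?thesis using assms by (simp add: nat_pow_mult nat_pow_pow)
qed

text \<open>
  Over \<open>{x, x\<^sup>t}\<close> the zero-sum condition becomes a congruence modulo the order of \<open>x\<close>, in which \<open>i\<close>, \<open>j\<close>
  count positive and \<open>i'\<close>, \<open>j'\<close> negative signs.
\<close>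

lemma pm_seqs_cyclic_pairE:
  assumes "x \<in> carrier G" "x [^] t \<noteq> x" "W \<in> pm_seqs G" "set_mset W \<subseteq> {x, x [^] (t::nat)}"
  obtains i i' j j' where "count W x = i + i'" "count W (x [^] t) = j + j'"
    "int (ord x) dvd (int i - int i') + int t * (int j - int j')"
proof -
  obtain P N where PN: "W = P + N" "mset_prod G P = mset_prod G N"
    using assms(3) by (rule pm_seqsE)
  then have "set_mset P \<subseteq> {x, x [^] t}" "set_mset N \<subseteq> {x, x [^] t}" using assms(4) by auto
  then have "x [^] (count P x + t * count P (x [^] t)) = x [^] (count N x + t * count N (x [^] t))"
    using PN(2) mset_prod_cyclic_pair assms(1,2) by metis
  then have "int (ord x) dvd (int (count P x) - int (count N x)) +
      int t * (int (count P (x [^] t)) - int (count N (x [^] t)))"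
    unfolding nat_pow_eq_iff[OF assms(1)] by (simp add: algebra_simps)
  then show thesis using that PN(1) by auto
qed

text \<open>
  The relation \<open>x\<^sup>N (x\<^sup>N)\<^bsup>-1\<^esup> = \<one>\<close> in a cyclic group of order \<open>2 N\<close>. Modulo \<open>2\<close> the multiplicities of \<open>x\<close> and \<open>x\<^sup>N\<close>
  have the same parity, and modulo \<open>N\<close> an odd multiplicity of \<open>x\<close> is at least \<open>N\<close>.
\<close>

lemma marked_atom_twice_odd:
  assumes x: "x \<in> carrier G" "ord x = 2 * N" and N: "odd N" "3 \<le> N"
  shows "marked_atom G (add_mset (x [^] N) (replicate_mset N x)) (x [^] N)"
proof -
  let ?e = "x [^] N"
  let ?V = "add_mset ?e (replicate_mset N x)"
  have ne: "?e \<noteq> x"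
  proof
    assume "?e = x"
    then have "x [^] N = x [^] (1::nat)" using x by simp
    then have "int (2 * N) dvd int N - 1" using nat_pow_eq_iff[OF x(1), of N 1] x(2) by simp
    then show False using N(2) by (auto dest: zdvd_imp_le)
  qed
  have setV: "set_mset ?V = {?e, x}" using N by auto
  have one: "x \<noteq> \<one>" "?e \<noteq> \<one>"
    using x N pow_eq_id[OF x(1), of N] ord_eq_1[OF x(1)] by (auto dest: dvd_imp_le)
  show ?thesis
  proof (rule marked_atomI)
    show "?V \<in> pm_seqs G"
      using pm_seqsI[of "{#?e#}" "replicate_mset N x"] x set_mset_replicate_mset_subset[of N x] by simp
    show "\<one> \<notin># ?V" using setV one by auto
    show "odd (count ?V ?e)" using ne by simp
    fix W assume W: "W \<in> pm_seqs G" "set_mset W \<subseteq> set_mset ?V"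
    then obtain i i' j j' where ij: "count W x = i + i'" "count W ?e = j + j'"
      "int (2 * N) dvd (int i - int i') + int N * (int j - int j')"
      using pm_seqs_cyclic_pairE[of x N W] x ne setV by (metis insert_commute)
    have "even ((int i - int i') + int N * (int j - int j'))"
      using ij(3) by (meson dvd_trans dvd_triv_left even_of_nat even_mult_iff)
    then have par: "even (i + i') \<longleftrightarrow> even (j + j')" using N(1) by auto
    have dv: "int N dvd int i - int i'"
      using ij(3) by (metis dvd_add_left_iff dvd_mult_right dvd_triv_left of_nat_mult)
    show "(\<forall>y\<in>set_mset ?V. even (count W y)) \<or>
      (\<exists>V'\<in>pm_seqs G. V' \<subseteq># W \<and> size V' = size ?V \<and> odd (count V' ?e) \<and>
          (\<forall>y\<in>set_mset ?V. even (count W y - count V' y)))"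
    proof (cases "even (i + i')")
      case True
      then show ?thesis using par ij setV by auto
    next
      case False
      then have "int i - int i' \<noteq> 0" by auto
      then have "int N \<le> \<bar>int i - int i'\<bar>" using dv by (simp add: zdvd_imp_le)
      then have "N \<le> count W x" using ij(1) by linarith
      moreover have "1 \<le> count W ?e" using par False ij(2) by (cases "j + j'") auto
      ultimately have "?V \<subseteq># W" using ne by (auto simp: subseteq_mset_def)
      moreover have "\<forall>y\<in>set_mset ?V. even (count W y - count ?V y)"
        using False par ij N ne unfolding setV by auto
      ultimately show ?thesis using \<open>?V \<in> pm_seqs G\<close> ne by (intro disjI2 bexI[of _ ?V]) auto
    qed
  qed
qed

text \<open>
  Modulo \<open>2\<close> the multiplicities of \<open>x\<close> and \<open>x\<^sup>3\<close> have the same parity. When both are odd, they cannot both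
  be \<open>1\<close> since none of \<open>1 + 3\<close>, \<open>1 - 3\<close> is divisible by \<open>8\<close>; so one of the two atoms
  \<open>x x x x\<^sup>3\<close> and \<open>x x\<^sup>3 x\<^sup>3 x\<^sup>3\<close> is contained.
\<close>

lemma marked_atom_eight:
  assumes x: "x \<in> carrier G" "ord x = 8"
  shows "marked_atom G {#x, x, x, x [^] (3::nat)#} x"
proof -
  let ?y = "x [^] (3::nat)"
  let ?V = "{#x, x, x, ?y#}" and ?V' = "{#x, ?y, ?y, ?y#}"
  have ne: "?y \<noteq> x" using nat_pow_eq_iff[OF x(1), of 3 1] x by auto
  have one: "x \<noteq> \<one>" "?y \<noteq> \<one>" using x pow_eq_id[OF x(1), of 3] ord_eq_1[OF x(1)] by auto
  have setV: "set_mset ?V = {x, ?y}" by auto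
  have V: "?V \<in> pm_seqs G"
    using pm_seqsI[of "{#x, x, x#}" "{#?y#}"] x by (simp add: numeral_3_eq_3 m_assoc add_mset_commute)
  have V': "?V' \<in> pm_seqs G"
  proof -
    have "x [^] (9::nat) = x [^] (1::nat)" using nat_pow_eq_iff[OF x(1), of 9 1] x(2) by simp
    then have "?y \<otimes> (?y \<otimes> ?y) = x" using x(1) by (simp add: nat_pow_mult)
    then show ?thesis using pm_seqsI[of "{#x#}" "{#?y, ?y, ?y#}"] x by (simp add: add_mset_commute)
  qed
  show ?thesis
  proof (rule marked_atomI)
    show "?V \<in> pm_seqs G" by fact
    show "\<one> \<notin># ?V" using one by auto
    show "odd (count ?V x)" using ne by simp
    fix W assume W: "W \<in> pm_seqs G" "set_mset W \<subseteq> set_mset ?V"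
    then obtain i i' j j' where ij: "count W x = i + i'" "count W ?y = j + j'"
      "int 8 dvd (int i - int i') + int 3 * (int j - int j')"
      using pm_seqs_cyclic_pairE[of x 3 W] x ne setV by metis
    have d8: "8 dvd (int i - int i') + 3 * (int j - int j')" using ij(3) by simp
    have "even ((int i - int i') + 3 * (int j - int j'))"
      using d8 by (rule dvd_trans[rotated]) simp
    then have par: "even (i + i') \<longleftrightarrow> even (j + j')" by auto
    show "(\<forall>y\<in>set_mset ?V. even (count W y)) \<or>
      (\<exists>V'\<in>pm_seqs G. V' \<subseteq># W \<and> size V' = size ?V \<and> odd (count V' x) \<and>
          (\<forall>y\<in>set_mset ?V. even (count W y - count V' y)))"
    proof (cases "even (i + i')")
      case True
      then show ?thesis using par ij setV by auto
    next
      case False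
      have pos: "x \<in># W" "?y \<in># W"
        using False par ij(1,2) by (auto simp flip: count_greater_zero_iff intro: odd_pos)
      have "3 \<le> i + i' \<or> 3 \<le> j + j'"
      proof (rule ccontr)
        assume "\<not> ?thesis"
        moreover have "m = 1" if "odd m" "\<not> 3 \<le> m" for m :: nat
          using that by presburger
        ultimately have "i + i' = 1" "j + j' = 1" using False par by blast+
        then have "i = 0 \<and> i' = 1 \<or> i = 1 \<and> i' = 0" "j = 0 \<and> j' = 1 \<or> j = 1 \<and> j' = 0"
          by (auto simp: add_is_1)
        then show False using d8 by auto
      qed
      then show ?thesis
      proof
        assume "3 \<le> i + i'"
        then have "?V \<subseteq># W" using ne ij(1,2) pos by (auto simp: subseteq_mset_def)
        moreover have "\<forall>y\<in>set_mset ?V. even (count W y - count ?V y)"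
          using False par ij ne by auto
        ultimately show ?thesis using V ne by (intro disjI2 bexI[of _ ?V]) auto
      next
        assume "3 \<le> j + j'"
        then have "?V' \<subseteq># W" using ne ij(1,2) pos by (auto simp: subseteq_mset_def)
        moreover have "\<forall>y\<in>set_mset ?V. even (count W y - count ?V' y)"
          using False par ij ne by auto
        ultimately show ?thesis using V' ne by (intro disjI2 bexI[of _ ?V']) auto
      qed
    qed
  qed
qed

text \<open>
  In \<open>C\<^sub>4 \<oplus> C\<^sub>2\<close> with basis \<open>g\<close>, \<open>e\<close>, a zero-sum sequence over \<open>{g, e, f}\<close> contains \<open>e\<close> and \<open>f\<close> with equal
  parity and \<open>g\<close> an even number of times. If \<open>e\<close> and \<open>f\<close> occur an odd number of times, the factors
  \<open>g\<^sup>2\<close> of \<open>f\<close> contribute \<open>2\<close> modulo \<open>4\<close>, which has to be compensated by at least two copies of \<open>g\<close>.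
\<close>

lemma marked_atom_four_two:
  assumes g: "g \<in> carrier G" "ord g = 4"
    and e: "e \<in> carrier G" "e \<otimes> e = \<one>" "e \<noteq> \<one>" "e \<noteq> g [^] (2::nat)"
    and f: "f = g [^] (2::nat) \<otimes> e"
  shows "marked_atom G {#g, g, e, f#} e"
proof -
  let ?h = "g [^] (2::nat)" let ?V = "{#g, g, e, f#}"
  have h: "?h \<in> carrier G" "?h \<otimes> ?h = \<one>" "?h \<noteq> \<one>" "g \<otimes> g = ?h"
    using g pow_eq_id[OF g(1), of 4] pow_eq_id[OF g(1), of 2]
    by (auto simp: nat_pow_mult) (simp add: numeral_2_eq_2)
  have ge: "g \<noteq> e" using h(3,4) e(2) by auto
  have fe: "f \<noteq> e" using h(1,3) e(1) by (simp add: f)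
  have "f \<otimes> f = (?h \<otimes> ?h) \<otimes> (e \<otimes> e)" using h(1) e(1) by (simp add: f m_ac)
  then have ff: "f \<otimes> f = \<one>" using h(2) e(2) by simp
  have fg: "f \<noteq> g"
  proof
    assume "f = g"
    then have "g \<otimes> g = \<one>" using ff by simp
    then show False using h(3,4) by simp
  qed
  have f1: "f \<noteq> \<one>"
  proof
    assume "f = \<one>"
    then have "?h \<otimes> e = ?h \<otimes> ?h" using h(2) by (simp add: f)
    then have "e = ?h" using h(1) e(1) l_cancel by blast
    then show False using e(4) by simp
  qed
  have g1: "g \<noteq> \<one>" using h(3) by auto
  have fcar: "f \<in> carrier G" using h e by (simp add: f)
  note ne = ge ge[symmetric] fe fe[symmetric] fg fg[symmetric]
  have epow: "e [^] (b::nat) = (if even b then \<one> else e)" for b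
    using e(1,2) by (induction b) auto
  have halve: "even z" if "4 dvd 2 * z" for z :: int
    using that by presburger
  have shift: "4 dvd z - 2" if "even z" "\<not> 4 dvd z" for z :: int
    using that by presburger
  have relation: "even (b + b') \<and> 4 dvd int a - int a'"
    if eq: "g [^] a \<otimes> e [^] b = g [^] a' \<otimes> e [^] b'" for a a' b b' :: nat
  proof -
    have "(g [^] a \<otimes> e [^] b) \<otimes> (g [^] a \<otimes> e [^] b) = g [^] (a + a) \<otimes> e [^] (b + b)" for a b :: nat
      using g e by (simp add: m_ac flip: nat_pow_mult)
    then have "g [^] (a + a) \<otimes> e [^] (b + b) = g [^] (a' + a') \<otimes> e [^] (b' + b')"
      using eq by metis
    then have "g [^] (a + a) = g [^] (a' + a')" using g(1) epow by simp
    then have "4 dvd int (a + a) - int (a' + a')" using nat_pow_eq_iff[OF g(1)] g(2) by simp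
    then have "4 dvd 2 * (int a - int a')" by (simp add: algebra_simps)
    then have ev: "even (int a - int a')" by (rule halve)
    have "even (b + b')"
    proof (rule ccontr)
      assume odd: "odd (b + b')"
      have mixed: False if "g [^] (c::nat) = g [^] (d::nat) \<otimes> e" "even (int c - int d)" for c d
      proof (cases "4 dvd int c - int d")
        case True
        then have "g [^] c = g [^] d" using nat_pow_eq_iff[OF g(1)] g(2) by simp
        then show False using that(1) g(1) e(1,3) by simp
      next
        case False
        then have "4 dvd int c - int (d + 2)" using shift[OF that(2)] by (simp add: algebra_simps)
        then have "g [^] c = g [^] (d + 2)" using nat_pow_eq_iff[OF g(1), of c "d + 2"] g(2) by simp
        then have "g [^] d \<otimes> ?h = g [^] d \<otimes> e" using that(1) g(1) by (simp add: nat_pow_mult)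
        then have "?h = e" using g(1) e(1) by simp
        then show False using e(4) by simp
      qed
      show False
        using odd eq ev mixed[of a a'] mixed[of a' a] g(1) e(1) epow[of b] epow[of b']
        by (cases "even b") (auto simp: dvd_diff_commute)
    qed
    then have "e [^] b = e [^] b'" using epow by simp
    then have "g [^] a = g [^] a'" using eq g e by simp
    then show ?thesis using \<open>even (b + b')\<close> nat_pow_eq_iff[OF g(1)] g(2) by simp
  qed
  have prod: "mset_prod G P = g [^] (count P g + 2 * count P f) \<otimes> e [^] (count P e + count P f)"
    if "set_mset P \<subseteq> {g, e, f}" for P
  proof -
    have "mset_prod G P = (\<Otimes>y\<in>{g, e, f}. y [^] count P y)"
      using that g(1) e(1) fcar by (intro mset_prod_superset) auto
    also have "\<dots> = g [^] count P g \<otimes> (e [^] count P e \<otimes> f [^] count P f)"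
      using g(1) e(1) fcar ne by simp
    also have "f [^] count P f = g [^] (2 * count P f) \<otimes> e [^] count P f"
      using g(1) e(1) by (simp add: f pow_mult_distrib m_comm nat_pow_pow)
    finally show ?thesis using g e by (simp add: m_ac flip: nat_pow_mult)
  qed
  show ?thesis
  proof (rule marked_atomI)
    show V: "?V \<in> pm_seqs G"
      using pm_seqsI[of "{#g, g, e#}" "{#f#}"] g(1) e(1) h m_comm[of e ?h]
      by (simp add: f add_mset_commute m_assoc[symmetric])
    show "\<one> \<notin># ?V" using g1 e f1 by auto
    show "odd (count ?V e)" using ge fe by simp
    fix W assume W: "W \<in> pm_seqs G" "set_mset W \<subseteq> set_mset ?V"
    obtain P N where PN: "W = P + N" "mset_prod G P = mset_prod G N"
      using W(1) by (rule pm_seqsE)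
    have "set_mset P \<subseteq> {g, e, f}" "set_mset N \<subseteq> {g, e, f}" using W(2) PN(1) by auto
    then have rel: "even ((count P e + count P f) + (count N e + count N f))"
      "4 dvd int (count P g + 2 * count P f) - int (count N g + 2 * count N f)"
      using relation PN(2) prod by metis+
    show "(\<forall>y\<in>set_mset ?V. even (count W y)) \<or>
      (\<exists>V'\<in>pm_seqs G. V' \<subseteq># W \<and> size V' = size ?V \<and> odd (count V' e) \<and>
          (\<forall>y\<in>set_mset ?V. even (count W y - count V' y)))"
    proof -
      have "even (int (count P g + 2 * count P f) - int (count N g + 2 * count N f))"
        using rel(2) by (rule dvd_trans[rotated]) simp
      then have cg: "even (count W g)" unfolding PN(1) by simp
      have cef: "even (count W e) \<longleftrightarrow> even (count W f)"
        using rel(1) unfolding PN(1) by auto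
      show ?thesis
      proof (cases "even (count W e)")
        case True
        then show ?thesis using cg cef by auto
      next
        case False
        have "count W g \<noteq> 0"
        proof
          assume "count W g = 0"
          then have "4 dvd 2 * (int (count P f) - int (count N f))"
            using rel(2) unfolding PN(1) by simp
          then have "even (int (count P f) - int (count N f))" by (rule halve)
          then have "even (count W f)" unfolding PN(1) by simp
          then show False using False cef by simp
        qed
        then have "2 \<le> count W g" using cg even_nonzero_ge_2 by blast
        moreover have "e \<in># W" "f \<in># W"
          using False cef by (simp_all add: odd_pos flip: count_greater_zero_iff)
        ultimately have "?V \<subseteq># W"
          using ne by (intro three_distinct_subseteq) auto
        moreover have "\<forall>y\<in>set_mset ?V. even (count W y - count ?V y)"
          using False cg cef ne by simp
        moreover have "size ?V = size ?V" "odd (count ?V e)" using ne by simp_all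
        ultimately show ?thesis using V by blast
      qed
    qed
  qed
qed

text \<open>
  In an elementary \<open>2\<close>-group signs do not matter, and independence of \<open>a\<close>, \<open>b\<close>, \<open>c\<close> makes the multiplicities of the
  four terms congruent modulo \<open>2\<close>. The hypotheses on \<open>a\<close>, \<open>b\<close>, \<open>c\<close> spell out independence.
\<close>

lemma marked_atom_elementary:
  assumes sq: "\<And>x. x \<in> carrier G \<Longrightarrow> x \<otimes> x = \<one>"
    and abc: "a \<in> carrier G" "b \<in> carrier G" "c \<in> carrier G"
    "a \<noteq> \<one>" "b \<noteq> \<one>" "b \<noteq> a" "c \<noteq> \<one>" "c \<noteq> a" "c \<noteq> b" "c \<noteq> a \<otimes> b"
    and d: "d = a \<otimes> b \<otimes> c"
  shows "marked_atom G {#a, b, c, d#} a"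
proof -
  let ?V = "{#a, b, c, d#}"
  have uniq: "x = y" if "x \<otimes> y = \<one>" "x \<in> carrier G" "y \<in> carrier G" for x y
    using that sq by (metis r_cancel)
  have pow: "x [^] (m::nat) = (if even m then \<one> else x)" if "x \<in> carrier G" for x m
    using that sq by (induction m) auto
  have ab: "a \<otimes> b \<noteq> \<one>" and ac: "a \<otimes> c \<noteq> \<one>" and bc: "b \<otimes> c \<noteq> \<one>" and d1: "d \<noteq> \<one>"
    using uniq abc unfolding d by (metis m_closed)+
  have "d = a \<otimes> (b \<otimes> c)" "d = b \<otimes> (a \<otimes> c)" using abc(1-3) by (simp_all add: d m_ac)
  then have da: "d \<noteq> a" and db: "d \<noteq> b"
    using abc(1-3) bc ac by (metis l_cancel_one m_closed)+
  have dc: "d \<noteq> c" using abc(1-3) ab by (simp add: d)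
  note ne = abc(6,8,9) abc(6,8,9)[symmetric] da db dc da[symmetric] db[symmetric] dc[symmetric]
  have dcar: "d \<in> carrier G" using abc by (simp add: d)
  have prod: "mset_prod G P = a [^] (count P a + count P d) \<otimes>
      (b [^] (count P b + count P d) \<otimes> c [^] (count P c + count P d))"
    if "set_mset P \<subseteq> {a, b, c, d}" for P
  proof -
    have "mset_prod G P = (\<Otimes>y\<in>{a, b, c, d}. y [^] count P y)"
      using that abc(1-3) dcar by (intro mset_prod_superset) auto
    also have "\<dots> = a [^] count P a \<otimes> (b [^] count P b \<otimes> (c [^] count P c \<otimes> d [^] count P d))"
      using abc(1-3) dcar ne by simp
    also have "d [^] count P d = a [^] count P d \<otimes> b [^] count P d \<otimes> c [^] count P d"
      using abc(1-3) by (simp add: d pow_mult_distrib m_comm)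
    finally show ?thesis using abc(1-3) by (simp add: m_ac flip: nat_pow_mult)
  qed
  show ?thesis
  proof (rule marked_atomI)
    show V: "?V \<in> pm_seqs G"
      using pm_seqsI[of "{#a, b, c#}" "{#d#}"] abc(1-3) dcar by (simp add: d add_mset_commute m_assoc)
    show "\<one> \<notin># ?V" using abc d1 by auto
    show "odd (count ?V a)" using abc da by simp
    fix W assume W: "W \<in> pm_seqs G" "set_mset W \<subseteq> set_mset ?V"
    obtain P N where PN: "W = P + N" "set_mset P \<subseteq> carrier G" "set_mset N \<subseteq> carrier G"
      "mset_prod G P = mset_prod G N"
      using W(1) by (rule pm_seqsE)
    have "mset_prod G W = \<one>" using PN sq by simp
    moreover have "set_mset W \<subseteq> {a, b, c, d}" using W(2) by auto
    ultimately have rel: "a [^] (count W a + count W d) \<otimes>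
      (b [^] (count W b + count W d) \<otimes> c [^] (count W c + count W d)) = \<one>"
      using prod by metis
    have "even (count W a + count W d) \<and> even (count W b + count W d) \<and> even (count W c + count W d)"
      using rel abc ab ac bc d1 unfolding pow[OF abc(1)] pow[OF abc(2)] pow[OF abc(3)]
      by (auto simp: d m_assoc split: if_splits)
    then have par: "even (count W a) \<longleftrightarrow> even (count W d)" "even (count W b) \<longleftrightarrow> even (count W d)"
      "even (count W c) \<longleftrightarrow> even (count W d)" by auto
    show "(\<forall>y\<in>set_mset ?V. even (count W y)) \<or>
      (\<exists>V'\<in>pm_seqs G. V' \<subseteq># W \<and> size V' = size ?V \<and> odd (count V' a) \<and>
          (\<forall>y\<in>set_mset ?V. even (count W y - count V' y)))"
    proof (cases "even (count W d)")
      case True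
      then show ?thesis using par by auto
    next
      case False
      have "a \<in># W" "b \<in># W" "c \<in># W" "d \<in># W"
        using False par by (simp_all add: odd_pos flip: count_greater_zero_iff)
      then have "?V \<subseteq># W"
        using ne by (intro four_distinct_subseteq) auto
      moreover have "\<forall>y\<in>set_mset ?V. even (count W y - count ?V y)"
        using False par ne by simp
      moreover have "size ?V = size ?V" "odd (count ?V a)" using ne by simp_all
      ultimately show ?thesis using V by blast
    qed
  qed
qed

text \<open>
  If some order has an odd divisor \<open>N \<ge> 3\<close>, multiplying an element of order \<open>N\<close> by the involution gives an element of
  order \<open>2 N\<close>. Otherwise all orders are powers of two, and then there is an element of order \<open>8\<close>, or a
  copy of \<open>C\<^sub>4 \<oplus> C\<^sub>2\<close>, or the group is elementary of rank at least three. Exactly the groups \<open>C\<^sub>2\<close>, \<open>C\<^sub>4\<close> and \<open>C\<^sub>2 \<oplus> C\<^sub>2\<close>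
  escape, which explains the bound on the cardinality.
\<close>

lemma involution_imp_even_marked_atom:
  assumes fin: "finite (carrier G)" and large: "5 \<le> card (carrier G)"
    and e: "e \<in> carrier G" "e \<otimes> e = \<one>" "e \<noteq> \<one>"
  obtains V m where "marked_atom G V m" "even (size V)" "4 \<le> size V"
proof -
  have outside: "\<exists>x\<in>carrier G. x \<notin> A" if A: "finite A" "card A \<le> 4" for A
  proof (rule ccontr)
    assume "\<not> ?thesis"
    then have "card (carrier G) \<le> card A" by (intro card_mono A) blast
    then show False using A(2) large by simp
  qed
  have pos: "0 < ord y" if "y \<in> carrier G" for y using ord_ge_1[OF fin that] by simp
  have subord: "ord (y [^] (ord y div d)) = d" if "y \<in> carrier G" "d dvd ord y" for y d
    using that pos[OF that(1)] ord_pow[of y "ord y div d"] by (auto elim!: dvdE)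
  consider
      (odd) y N where "y \<in> carrier G" "odd N" "3 \<le> N" "N dvd ord y"
    | (eight) y where "y \<in> carrier G" "8 dvd ord y"
    | (four) "\<forall>y\<in>carrier G. ord y dvd 4"
  proof -
    have "(\<exists>N. odd N \<and> 3 \<le> N \<and> N dvd ord y) \<or> 8 dvd ord y \<or> ord y dvd 4" if y: "y \<in> carrier G" for y
    proof -
      obtain k m where km: "ord y = 2 ^ k * m" "odd m"
        using pos[OF y] by (rule nat_two_power_times_odd)
      have "m = 1 \<or> 3 \<le> m" using km(2) by presburger
      then consider "3 \<le> m" | "m = 1" "3 \<le> k" | "m = 1" "k \<le> 2" by linarith
      then show ?thesis
      proof cases
        case 2
        then show ?thesis using km(1) le_imp_power_dvd[of 3 k "2::nat"] by simp
      next
        case 3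
        then show ?thesis using km(1) le_imp_power_dvd[of k 2 "2::nat"] by simp
      qed (use km in auto)
    qed
    then show ?thesis using that by blast
  qed
  then show thesis
  proof cases
    case odd
    define g where "g = y [^] (ord y div N)"
    have g: "g \<in> carrier G" "ord g = N" using odd subord by (auto simp: g_def)
    have epow: "e [^] (b::nat) = (if even b then \<one> else e)" for b
      using e by (induction b) auto
    have gpow: "g [^] n = \<one> \<longleftrightarrow> N dvd n" for n :: nat using pow_eq_id g by simp
    have "(g \<otimes> e) [^] n = \<one> \<longleftrightarrow> 2 * N dvd n" for n :: nat
    proof
      assume *: "(g \<otimes> e) [^] n = \<one>"
      have "(g \<otimes> e) [^] (k * n) = \<one>" for k
        using g(1) e(1) * nat_pow_pow[of "g \<otimes> e" n k] by (simp add: mult.commute)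
      then have "(g \<otimes> e) [^] (N * n) = \<one>" "(g \<otimes> e) [^] (2 * n) = \<one>" by blast+
      moreover have "(g \<otimes> e) [^] (N * n) = e [^] (N * n)" "(g \<otimes> e) [^] (2 * n) = g [^] (2 * n)"
        using g e gpow[of "N * n"] epow[of "2 * n"] by (simp_all add: pow_mult_distrib m_comm)
      ultimately have "even (N * n)" "N dvd 2 * n" using epow[of "N * n"] gpow e by (auto split: if_splits)
      then have "2 dvd n" "N dvd n"
        using odd(2) by (auto simp: coprime_dvd_mult_right_iff)
      then show "2 * N dvd n" using odd(2) by (intro divides_mult) auto
    next
      assume "2 * N dvd n"
      then have "even n" "N dvd n" by (auto elim: dvd_mult_left dvd_mult_right)
      then show "(g \<otimes> e) [^] n = \<one>" using g e gpow epow by (simp add: pow_mult_distrib m_comm)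
    qed
    then have "ord (g \<otimes> e) = 2 * N" using g e by (simp add: ord_unique)
    then have "marked_atom G (add_mset ((g \<otimes> e) [^] N) (replicate_mset N (g \<otimes> e))) ((g \<otimes> e) [^] N)"
      using g(1) e(1) odd(2,3) by (intro marked_atom_twice_odd) auto
    then show thesis by (rule that) (use odd(2,3) in auto)
  next
    case eight
    then have "y [^] (ord y div 8) \<in> carrier G" "ord (y [^] (ord y div 8)) = 8" using subord by auto
    then show thesis by (rule that[OF marked_atom_eight]) auto
  next
    case four
    have pow4: "y [^] (4::nat) = \<one>" if "y \<in> carrier G" for y
      using four that by (simp add: pow_eq_id)
    have sqsq: "(y \<otimes> y) \<otimes> (y \<otimes> y) = \<one>" if "y \<in> carrier G" for y
      using pow4[OF that] that by (simp add: numeral_eq_Suc m_assoc)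
    show thesis
    proof (cases "\<exists>g\<in>carrier G. g \<otimes> g \<noteq> \<one>")
      case True
      then obtain g where g: "g \<in> carrier G" "g \<otimes> g \<noteq> \<one>" by blast
      have g2: "g [^] (2::nat) = g \<otimes> g" using g by (simp add: numeral_2_eq_2)
      have "\<not> ord g dvd 2" using g g2 pow_eq_id[OF g(1), of 2] by simp
      then have ord4: "ord g = 4" using four g(1) by (intro dvd_four_not_dvd_two) auto
      have "card {\<one>, g, g \<otimes> g, inv g} \<le> 4" by (simp add: card_insert_if)
      then obtain h where h: "h \<in> carrier G" "h \<notin> {\<one>, g, g \<otimes> g, inv g}"
        using outside[of "{\<one>, g, g \<otimes> g, inv g}"] by auto
      \<comment> \<open>An involution outside the subgroup generated by \<open>g\<close>, obtained from any outside element \<open>h\<close> by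
        looking at where \<open>h \<otimes> h\<close>, whose square is trivial, lies.\<close>
      obtain c where c: "c \<in> carrier G" "c \<otimes> c = \<one>" "c \<noteq> \<one>" "c \<noteq> g \<otimes> g"
      proof -
        have "\<exists>c\<in>carrier G. c \<otimes> c = \<one> \<and> c \<noteq> \<one> \<and> c \<noteq> g \<otimes> g"
      proof -
        consider "h \<otimes> h \<notin> {\<one>, g \<otimes> g}" | "h \<otimes> h = \<one>" | "h \<otimes> h = g \<otimes> g" by blast
        then show ?thesis
        proof cases
          case 1
          then show ?thesis using h sqsq by (intro bexI[of _ "h \<otimes> h"]) auto
        next
          case 2
          then show ?thesis using h by (intro bexI[of _ h]) auto
        next
          case 3
          have "(h \<otimes> g) \<otimes> (h \<otimes> g) = (h \<otimes> h) \<otimes> (g \<otimes> g)" using h g by (simp add: m_ac)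
          then have "(h \<otimes> g) \<otimes> (h \<otimes> g) = \<one>" using 3 sqsq g by simp
          moreover have "h \<otimes> g \<noteq> \<one>" using h g inv_equality by auto
          moreover have "h \<otimes> g \<noteq> g \<otimes> g" using h g by simp
          ultimately show ?thesis using h g by (intro bexI[of _ "h \<otimes> g"]) auto
        qed
      qed
        then show thesis using that by blast
      qed
      have "marked_atom G {#g, g, c, g [^] (2::nat) \<otimes> c#} c"
        using g(1) ord4 c g2 by (intro marked_atom_four_two) auto
      then show thesis by (rule that) auto
    next
      case False
      have "card {\<one>, e} \<le> 4" by (simp add: card_insert_if)
      then obtain b where b: "b \<in> carrier G" "b \<notin> {\<one>, e}" using outside[of "{\<one>, e}"] by auto
      have "card {\<one>, e, b, e \<otimes> b} \<le> 4" by (simp add: card_insert_if)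
      then obtain c where c: "c \<in> carrier G" "c \<notin> {\<one>, e, b, e \<otimes> b}"
        using outside[of "{\<one>, e, b, e \<otimes> b}"] by auto
      have "marked_atom G {#e, b, c, e \<otimes> b \<otimes> c#} e"
        using False b c e by (intro marked_atom_elementary) auto
      then show thesis by (rule that) auto
    qed
  qed
qed

end

section \<open>Groups of odd order with short atoms\<close>

context comm_group
begin

lemma marked_atom_odd_power:
  assumes g: "g \<in> carrier G" "g \<noteq> \<one>" "odd (ord g)"
  shows "marked_atom G (replicate_mset (ord g) g) g"
proof (rule marked_atomI)
  let ?V = "replicate_mset (ord g) g"
  show V: "?V \<in> pm_seqs G" using atom_odd_power[OF g(1,3)] pm_atoms_subset by blast
  show "\<one> \<notin># ?V" using g(2) by auto
  show "odd (count ?V g)" using g(3) by simp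
  fix W assume W: "W \<in> pm_seqs G" "set_mset W \<subseteq> set_mset ?V"
  have "set_mset W \<subseteq> {g}" using W(2) by (auto split: if_splits)
  then obtain A where A: "W = replicate_mset A g"
    using set_mset_subset_singletonD by metis
  show "(\<forall>x\<in>set_mset ?V. even (count W x)) \<or>
      (\<exists>V'\<in>pm_seqs G. V' \<subseteq># W \<and> size V' = size ?V \<and> odd (count V' g) \<and>
          (\<forall>x\<in>set_mset ?V. even (count W x - count V' x)))"
  proof (cases "even A")
    case True
    then show ?thesis using A by (auto split: if_splits)
  next
    case False
    then have "ord g \<le> A" using odd_replicate_pm_seqs[OF g(1) False] W(1) A by simp
    then have "?V \<subseteq># W" using A by (simp flip: count_le_replicate_mset_subset_eq)
    moreover have "\<forall>x\<in>set_mset ?V. even (count W x - count ?V x)"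
      using A False g(3) by (auto split: if_splits)
    ultimately show ?thesis using V g(3) by (intro disjI2 bexI[of _ ?V]) auto
  qed
qed

lemma sub_replicate_mset:
  assumes "P + N = replicate_mset a g"
  obtains i j where "P = replicate_mset i g" "N = replicate_mset j g" "i + j = a"
proof -
  obtain i j where ij: "P = replicate_mset i g" "N = replicate_mset j g"
    using assms by (metis mset_subset_eq_add_left mset_subset_eq_add_right msubseteq_replicate_msetE)
  then have "i + j = a" using arg_cong[OF assms, of size] by simp
  then show thesis using that ij by blast
qed

text \<open>
  Changing all signs at once, a chosen term may be assumed to have sign \<open>1\<close>.
\<close>

lemma pm_seqs_memberE:
  assumes "add_mset x W \<in> pm_seqs G"
  obtains (result) P N where "W = P + N" "x \<in> carrier G" "set_mset P \<subseteq> carrier G" "set_mset N \<subseteq> carrier G"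
    "x \<otimes> mset_prod G P = mset_prod G N"
proof -
  obtain P N where PN: "add_mset x W = P + N" "set_mset P \<subseteq> carrier G" "set_mset N \<subseteq> carrier G"
    "mset_prod G P = mset_prod G N" using assms by (rule pm_seqsE)
  have *: thesis if "add_mset x W = P + N" "set_mset P \<subseteq> carrier G" "set_mset N \<subseteq> carrier G"
    "mset_prod G P = mset_prod G N" "x \<in># P" for P N
  proof -
    obtain P' where P': "P = add_mset x P'" using \<open>x \<in># P\<close> by (metis mset_add)
    then show thesis using that by (intro result[of P' N]) auto
  qed
  have "x \<in># P + N" using PN(1) by (metis union_single_eq_member)
  then show thesis using *[of P N] *[of N P] PN by (auto simp: add.commute[of N P])
qed

lemma replicate_with_one_pm_seqs:
  assumes g: "g \<in> carrier G" and W: "add_mset x (replicate_mset a g) \<in> pm_seqs G"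
  shows "\<exists>k::int. x = g [^] k"
proof -
  obtain P N where PN: "replicate_mset a g = P + N" "x \<in> carrier G"
    "x \<otimes> mset_prod G P = mset_prod G N" using W by (rule pm_seqs_memberE)
  obtain i j where "P = replicate_mset i g" "N = replicate_mset j g"
    using PN(1)[symmetric] by (rule sub_replicate_mset)
  then have "x \<otimes> g [^] i = g [^] j" using PN(3) g by simp
  then have "x = g [^] j \<otimes> inv (g [^] i)" using PN(2) g by (simp add: inv_solve_right)
  also have "\<dots> = g [^] (int j - int i)" using g by (simp add: int_pow_diff int_pow_int)
  finally show ?thesis by blast
qed

text \<open>
  An element of odd order is a power of its own square.
\<close>

lemma odd_order_sqrt:
  assumes g: "g \<in> carrier G" and h: "h \<in> carrier G" "odd (ord h)" and "h \<otimes> h = g [^] (k::int)"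
  shows "\<exists>k::int. h = g [^] k"
proof -
  obtain m where m: "ord h = 2 * m + 1" using h(2) by (elim oddE)
  have "h = h [^] (ord h + 1)" using h(1) by simp
  also have "\<dots> = (h \<otimes> h) [^] (m + 1)"
    using h(1) m by (simp add: pow_mult_distrib nat_pow_mult m_ac flip: mult_2)
  also have "\<dots> = g [^] (k * int (m + 1))"
    unfolding assms(4) using g by (simp add: int_pow_pow flip: int_pow_int)
  finally show ?thesis by blast
qed

text \<open>
  For \<open>h\<close> outside the subgroup generated by \<open>g\<close> and \<open>n\<close> the order of \<open>g\<close>, the sequence \<open>g\<^bsup>n-1\<^esup> (g h) h\<close>
  would be an atom with \<open>n + 1\<close> terms. Indeed, modulo that subgroup, \<open>h\<close> and \<open>g h\<close> must lie in the same part of a splitting.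
  The other part is \<open>g\<^sup>b\<close> with \<open>b < n\<close>, hence \<open>b\<close> is even. In the part with \<open>h\<close>, equal signs of \<open>h\<close> and \<open>g h\<close> would make
  \<open>h\<^sup>2\<close> a power of \<open>g\<close>, and opposite signs leave a power of \<open>g\<close> with an odd exponent too small to vanish unless \<open>b = 0\<close>.
\<close>

lemma odd_cyclic_of_bounded_atoms:
  assumes odd: "\<And>x. x \<in> carrier G \<Longrightarrow> odd (ord x)"
    and bound: "\<And>U. U \<in> pm_atoms G \<Longrightarrow> size U \<le> ord g"
    and g: "g \<in> carrier G" and h: "h \<in> carrier G"
  shows "\<exists>k::int. h = g [^] k"
proof (rule ccontr)
  assume h': "\<nexists>k::int. h = g [^] k"
  let ?n = "ord g"
  have n: "odd ?n" "0 < ?n" using odd[OF g] by (auto intro: odd_pos)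
  let ?V = "add_mset h (add_mset (g \<otimes> h) (replicate_mset (?n - 1) g))"
  have gR: "set_mset (replicate_mset a g) \<subseteq> carrier G" for a using g by auto
  have "?V \<in> pm_seqs G"
  proof -
    have "g [^] (?n - 1) \<otimes> (g \<otimes> h) = g [^] (?n - 1 + 1) \<otimes> h"
      using g h by (simp add: m_assoc flip: nat_pow_mult)
    then have "(g \<otimes> h) \<otimes> g [^] (?n - 1) = h" using g h n(2) by (simp add: m_comm)
    then show ?thesis
      using pm_seqsI[of "{#h#}" "add_mset (g \<otimes> h) (replicate_mset (?n - 1) g)"] g h gR
      by (simp add: add_mset_commute)
  qed
  moreover have no_split: "T = {#}"
    if ST: "S \<in> pm_seqs G" "T \<in> pm_seqs G" "?V = S + T" "h \<in># S" for S T
  proof (rule ccontr)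
    assume T: "T \<noteq> {#}"
    obtain S' where S': "S = add_mset h S'" using ST(4) by (metis mset_add)
    then have eq: "add_mset (g \<otimes> h) (replicate_mset (?n - 1) g) = S' + T" using ST(3) by simp
    have "g \<otimes> h \<in># S' + T" using eq by (metis union_single_eq_member)
    then consider "g \<otimes> h \<in># T" | "g \<otimes> h \<in># S'" by auto
    then show False
    proof cases
      case 1
      then obtain T' where "T = add_mset (g \<otimes> h) T'" by (metis mset_add)
      then have "S' + T' = replicate_mset (?n - 1) g" using eq by simp
      then obtain a where "S' = replicate_mset a g" by (rule sub_replicate_mset)
      then show False using replicate_with_one_pm_seqs[OF g] ST(1) S' h' by blast
    next
      case 2
      then obtain R where R: "S' = add_mset (g \<otimes> h) R" by (metis mset_add)
      then have "R + T = replicate_mset (?n - 1) g" using eq by simp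
      then obtain a b where ab: "R = replicate_mset a g" "T = replicate_mset b g" "a + b = ?n - 1"
        by (rule sub_replicate_mset)
      have "even b" using odd_replicate_pm_seqs[OF g, of b] ST(2) ab n(2) by fastforce
      moreover have "b \<noteq> 0" using T ab(2) by auto
      moreover have "even (a + b)" using ab(3) n by simp
      ultimately have "even a" "b \<noteq> 1" by auto
      moreover from this have "a + 1 < ?n" using ab(3) \<open>b \<noteq> 0\<close> n(2) by linarith
      ultimately have a: "even a" "a + 1 < ?n" by blast+
      have "add_mset h (add_mset (g \<otimes> h) (replicate_mset a g)) \<in> pm_seqs G"
        using ST(1) S' R ab(1) by simp
      then obtain P N where PN: "add_mset (g \<otimes> h) (replicate_mset a g) = P + N"
        "set_mset P \<subseteq> carrier G" "set_mset N \<subseteq> carrier G"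
        "h \<otimes> mset_prod G P = mset_prod G N" by (rule pm_seqs_memberE)
      have "g \<otimes> h \<in># P + N" using PN(1) by (metis union_single_eq_member)
      then consider "g \<otimes> h \<in># P" | "g \<otimes> h \<in># N" by auto
      then show False
      proof cases
        case 1
        then obtain P' where P': "P = add_mset (g \<otimes> h) P'" by (metis mset_add)
        then have "P' + N = replicate_mset a g" using PN(1) by simp
        then obtain i j where ij: "P' = replicate_mset i g" "N = replicate_mset j g"
          by (rule sub_replicate_mset)
        have "h \<otimes> ((g \<otimes> h) \<otimes> g [^] i) = g [^] j"
          using PN(4) P' ij g h gR by simp
        then have "(h \<otimes> h) \<otimes> g [^] (i + 1) = g [^] j"
          using g h by (simp add: m_ac flip: nat_pow_mult)
        then have "h \<otimes> h = g [^] j \<otimes> inv (g [^] (i + 1))" using g h by (simp add: inv_solve_right)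
        also have "\<dots> = g [^] (int j - int (i + 1))"
          using g by (simp only: int_pow_diff int_pow_int)
        finally show False using odd_order_sqrt[OF g h odd[OF h]] h' by blast
      next
        case 2
        then obtain N' where N': "N = add_mset (g \<otimes> h) N'" by (metis mset_add)
        then have "P + N' = replicate_mset a g" using PN(1) by simp
        then obtain i j where ij: "P = replicate_mset i g" "N' = replicate_mset j g" "i + j = a"
          by (rule sub_replicate_mset)
        have "h \<otimes> g [^] i = (g \<otimes> h) \<otimes> g [^] j"
          using PN(4) N' ij g h gR by simp
        then have "h \<otimes> g [^] i = h \<otimes> g [^] (j + 1)"
          using g h by (simp add: m_ac flip: nat_pow_mult)
        then have "g [^] i = g [^] (j + 1)" using g h by (simp del: nat_pow_Suc)
        then have dvd: "int ?n dvd int i - int (j + 1)" using nat_pow_eq_iff[OF g] by blast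
        have "i \<noteq> j + 1" using ij(3) a(1) by auto
        then have "int i - int (j + 1) \<noteq> 0" by linarith
        then have "int ?n \<le> \<bar>int i - int (j + 1)\<bar>" using dvd by (simp add: zdvd_imp_le)
        then show False using ij(3) a(2) by linarith
      qed
    qed
  qed
  ultimately have "?V \<in> pm_atoms G"
    unfolding pm_atoms_def
  proof (intro CollectI conjI ballI impI)
    fix S T assume ST: "S \<in> pm_seqs G" "T \<in> pm_seqs G" "?V = S + T"
    have "h \<in># S + T" using ST(3) by (metis union_single_eq_member)
    then show "S = {#} \<or> T = {#}" using no_split[of S T] no_split[of T S] ST by (auto simp: add.commute)
  qed auto
  from bound[OF this] show False using n(2) by simp
qed

end

section \<open>Comparing systems of sets of lengths\<close>

abbreviation pm_system :: "('a, 'b) monoid_scheme \<Rightarrow> nat set set" where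
  "pm_system G \<equiv> system_of_sets_of_lengths (pm_zero_sum_monoid G)"

lemma pm_system_subsetE:
  assumes "pm_system G \<subseteq> pm_system H" "S \<in> pm_seqs G"
  obtains T where "T \<in> pm_seqs H" "pm_lengths H T = pm_lengths G S"
  using assms unfolding system_of_sets_of_lengths_def by blast

text \<open>
  The set of lengths of \<open>V V\<close> contains \<open>2\<close> and \<open>|V|\<close>, and in \<open>H\<close> a product of two atoms has weight at
  most \<open>2 m\<close>.
\<close>

lemma atom_bound_transfer:
  assumes "comm_group G" "comm_group H" and sub: "pm_system G \<subseteq> pm_system H"
    and bound: "\<And>U. U \<in> pm_atoms H \<Longrightarrow> size U \<le> m" "2 \<le> m" and V: "V \<in> pm_atoms G"
  shows "size V \<le> m"
proof -
  interpret G: comm_group G by fact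
  interpret H: comm_group H by fact
  show ?thesis
  proof (cases "V = {#\<one>\<^bsub>G\<^esub>#}")
    case True
    then show ?thesis using bound(2) by simp
  next
    case False
    then have one: "\<one>\<^bsub>G\<^esub> \<notin># V" using G.atom_cases[OF V] by blast
    have Vs: "V \<in> pm_seqs G" using V G.pm_atoms_subset by blast
    then obtain T where T: "T \<in> pm_seqs H" "pm_lengths H T = pm_lengths G (V + V)"
      using pm_system_subsetE[OF sub G.pm_seqs_add] by metis
    have "2 \<in> pm_lengths H T"
      using G.pm_lengthsI[of "[V, V]"] V T(2) by (simp add: numeral_2_eq_2)
    then have "size T + count T \<one>\<^bsub>H\<^esub> \<le> m * 2" using H.length_bounds(3) bound by blast
    moreover have "size V \<in> pm_lengths H T"
      using G.pm_lengths_double[OF G.pm_seqs_subset[OF Vs] one] T(2) by simp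
    then have "2 * size V \<le> size T + count T \<one>\<^bsub>H\<^esub>" by (rule H.length_bounds(1))
    ultimately show ?thesis by simp
  qed
qed

text \<open>
  The set of lengths of \<open>V\<^bsup>2k\<^esup>\<close> is realized in \<open>H\<close>. For \<open>k = |H|\<^sup>2\<close> its range \<open>k (|V| - 2)\<close> is so large that an
  element \<open>g \<noteq> \<one>\<close> of \<open>H\<close> admits the exchange of lengths, whose effect \<open>ord g - 2\<close> is then a multiple of \<open>|V| - 2\<close>.
\<close>

lemma marked_atom_exchange:
  assumes "comm_group G" "comm_group H" and sub: "pm_system G \<subseteq> pm_system H"
    and fin: "finite (carrier H)" and odd: "\<And>x. x \<in> carrier H \<Longrightarrow> odd (group.ord H x)"
    and V: "marked_atom G V e" "4 \<le> size V"
  obtains g c where "g \<in> carrier H" "g \<noteq> \<one>\<^bsub>H\<^esub>" "group.ord H g = 2 + c * (size V - 2)"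
proof -
  interpret G: comm_group G by fact
  interpret H: comm_group H by fact
  let ?N = "card (carrier H)"
  let ?k = "?N ^ 2"
  note L = G.marked_atom_lengths[OF V(1), where k = ?k]
  obtain T where T: "T \<in> pm_seqs H"
    "pm_lengths H T = pm_lengths G (repeat_mset ?k (V + V))"
    using pm_system_subsetE[OF sub L(1)] by metis
  have "?k * 4 \<le> ?k * size V" using V(2) by simp
  then have "3 * ?N ^ 2 + 2 * (2 * ?k) \<le> 2 * (?k * size V)" by linarith
  then obtain g where g: "g \<in> carrier H" "g \<noteq> \<one>\<^bsub>H\<^esub>" "3 * ?N \<le> count T g"
    using H.frequent_element[OF fin T(1), of "2 * ?k" "?k * size V"] L(2,3) T(2) by metis
  have "H.ord g \<le> ?N" using H.ord_le_group_order[OF fin g(1)] by (simp add: order_def)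
  then have "3 * H.ord g \<le> count T g" using g(3) by simp
  then obtain l where l: "l + 2 \<in> pm_lengths H T" "l + H.ord g \<in> pm_lengths H T"
    using H.odd_order_exchange[OF g(1,2) odd[OF g(1)] T(1)] by metis
  obtain i where i: "l + 2 + i * (size V - 2) = ?k * size V"
    using L(4)[of "l + 2"] l(1) T(2) by auto
  obtain j where j: "l + H.ord g + j * (size V - 2) = ?k * size V"
    using L(4)[of "l + H.ord g"] l(2) T(2) by auto
  have "H.ord g \<noteq> 1" using H.ord_eq_1 g(1,2) by blast
  moreover have "0 < H.ord g" using odd[OF g(1)] by (rule odd_pos)
  moreover have "H.ord g \<noteq> 2" using odd[OF g(1)] by auto
  ultimately have p: "2 < H.ord g" by linarith
  have *: "2 + i * (size V - 2) = H.ord g + j * (size V - 2)" using i j by linarith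
  have "j \<le> i"
  proof (rule ccontr)
    assume "\<not> j \<le> i"
    then have "i * (size V - 2) \<le> j * (size V - 2)" by simp
    then show False using * p by linarith
  qed
  then obtain c where "i = j + c" using le_Suc_ex by blast
  then have "H.ord g = 2 + c * (size V - 2)" using * by (simp add: add_mult_distrib)
  then show thesis using that g by blast
qed

lemma marked_atom_size_odd:
  assumes "comm_group G" "comm_group H" "pm_system G \<subseteq> pm_system H"
    and "finite (carrier H)" and odd: "\<And>x. x \<in> carrier H \<Longrightarrow> odd (group.ord H x)"
    and "marked_atom G V e" "4 \<le> size V"
  shows "odd (size V)"
proof -
  obtain g c where "g \<in> carrier H" "group.ord H g = 2 + c * (size V - 2)"
    using marked_atom_exchange[OF assms] by metis
  then have "odd (2 + c * (size V - 2))" using odd by metis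
  then show ?thesis by auto
qed

lemma (in group) iso_integer_mod_group:
  assumes g: "g \<in> carrier G" "0 < ord g"
    and gen: "\<And>h. h \<in> carrier G \<Longrightarrow> \<exists>k::int. h = g [^] k"
  shows "G \<cong> integer_mod_group (ord g)"
proof -
  let ?n = "ord g"
  let ?f = "\<lambda>k::int. g [^] k"
  have car: "carrier (integer_mod_group ?n) = {0..<int ?n}"
    using g(2) by (simp add: carrier_integer_mod_group)
  have red: "?f (k mod int ?n) = ?f k" for k
    using g(1) int_pow_eq by (simp add: minus_mod_eq_mult_div)
  have "?f \<in> iso (integer_mod_group ?n) G"
  proof (rule isoI)
    show "?f \<in> hom (integer_mod_group ?n) G"
      using g(1) red by (intro homI) (auto simp: int_pow_mult)
    have "inj_on ?f {0..<int ?n}"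
    proof (rule inj_onI)
      fix x y assume *: "x \<in> {0..<int ?n}" "y \<in> {0..<int ?n}" "?f x = ?f y"
      then have "int ?n dvd y - x" using int_pow_eq[OF g(1)] by simp
      then have "y mod int ?n = x mod int ?n" by (simp add: mod_eq_dvd_iff)
      then show "x = y" using * by simp
    qed
    moreover have "?f ` {0..<int ?n} = carrier G"
    proof
      show "?f ` {0..<int ?n} \<subseteq> carrier G" using g(1) by auto
      show "carrier G \<subseteq> ?f ` {0..<int ?n}"
      proof
        fix h assume "h \<in> carrier G"
        then obtain k where "h = ?f k" using gen by blast
        then show "h \<in> ?f ` {0..<int ?n}"
          using red[of k] g(2) by (intro image_eqI[of _ _ "k mod int ?n"]) auto
      qed
    qed
    ultimately show "bij_betw ?f (carrier (integer_mod_group ?n)) (carrier G)"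
      unfolding car bij_betw_def by blast
  qed
  then have "integer_mod_group ?n \<cong> G" by (rule is_isoI)
  then show ?thesis using group.iso_sym[OF group_integer_mod_group] by blast
qed

lemma (in comm_group) cyclic_of_same_system:
  assumes fin: "finite (carrier G)" and n: "n \<ge> 5" "odd n"
    and same: "pm_system G = pm_system (integer_mod_group n)"
  shows "G \<cong> integer_mod_group n"
proof -
  interpret C: comm_group "integer_mod_group n" by simp
  have sub: "pm_system G \<subseteq> pm_system (integer_mod_group n)"
    and sup: "pm_system (integer_mod_group n) \<subseteq> pm_system G"
    using same by simp_all
  have carC: "carrier (integer_mod_group n) = {0..<int n}"
    using n(1) by (simp add: carrier_integer_mod_group)
  then have finC: "finite (carrier (integer_mod_group n))"
    and cardC: "card (carrier (integer_mod_group n)) = n" by simp_all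
  have oddC: "odd (C.ord x)" if "x \<in> carrier (integer_mod_group n)" for x
    using C.ord_dvd_group_order[OF that] cardC n(2) dvd_trans[of 2 "C.ord x" n]
    by (auto simp: order_def)
  have one: "1 \<in> carrier (integer_mod_group n)" using n(1) by simp
  have ord1: "C.ord 1 = n"
    unfolding C.ord_unique[OF one] by (auto simp flip: zmod_int)
  let ?V = "replicate_mset n (1::int)"
  have V: "marked_atom (integer_mod_group n) ?V 1"
    using C.marked_atom_odd_power[OF one] ord1 n(2) by simp
  then have atomV: "?V \<in> pm_atoms (integer_mod_group n)" by (simp add: marked_atom_def)

  have bound: "size U \<le> n" if "U \<in> pm_atoms G" for U
    using atom_bound_transfer[OF comm_group_axioms C.comm_group_axioms sub _ _ that, of n]
      C.atom_size_le_order[OF finC] cardC n(1) by simp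
  \<comment> \<open>The maximum with \<open>2\<close> covers trivial \<open>G\<close>, where atoms transfer only up to size two.\<close>
  have "size ?V \<le> max 2 (card (carrier G))"
    using atom_bound_transfer[OF C.comm_group_axioms comm_group_axioms sup _ _ atomV]
      atom_size_le_order[OF fin] by (meson le_max_iff_disj max.cobounded1)
  then have large: "5 \<le> card (carrier G)" using n(1) by simp

  have odd: "odd (ord x)" if x: "x \<in> carrier G" for x
  proof
    assume "even (ord x)"
    then obtain m where m: "ord x = 2 * m" by blast
    have "0 < ord x" using ord_ge_1[OF fin x] by simp
    then have "\<not> ord x dvd m" using m by (auto dest: dvd_imp_le)
    then have "x [^] m \<noteq> \<one>" using pow_eq_id[OF x] by simp
    moreover have "x [^] m \<otimes> x [^] m = x [^] ord x" using x m by (simp add: nat_pow_mult mult_2)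
    then have "x [^] m \<otimes> x [^] m = \<one>" using x by simp
    ultimately obtain V' e where "marked_atom G V' e" "even (size V')" "4 \<le> size V'"
      using involution_imp_even_marked_atom[OF fin large, of "x [^] m"] x by auto
    then show False
      using marked_atom_size_odd[OF comm_group_axioms C.comm_group_axioms sub finC oddC] by blast
  qed

  obtain g c where g: "g \<in> carrier G" "g \<noteq> \<one>" "ord g = 2 + c * (n - 2)"
    using marked_atom_exchange[OF C.comm_group_axioms comm_group_axioms sup fin odd V] n(1) by auto
  have "ord g \<le> n" using bound[OF atom_odd_power[OF g(1) odd[OF g(1)]]] by simp
  moreover have "c \<noteq> 0"
  proof
    assume "c = 0"
    then show False using odd[OF g(1)] g(3) by simp
  qed
  then have "n - 2 \<le> c * (n - 2)" by simp
  ultimately have ordg: "ord g = n" using g(3) by linarith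
  have "\<exists>k::int. h = g [^] k" if "h \<in> carrier G" for h
    using odd_cyclic_of_bounded_atoms[OF odd _ g(1) that] bound ordg by blast
  then have "G \<cong> integer_mod_group (ord g)"
    using n(1) ordg by (intro iso_integer_mod_group g(1)) auto
  then show ?thesis using ordg by simp
qed

theorem theorem4p6:
  fixes G :: "('a, 'b) monoid_scheme" and n :: nat
  assumes "comm_group G" and "finite (carrier G)"
    and "n \<ge> 5" and "odd n"
    and "system_of_sets_of_lengths (pm_zero_sum_monoid G) =
         system_of_sets_of_lengths (pm_zero_sum_monoid (integer_mod_group n))"
  shows "G \<cong> integer_mod_group n"
  using assms by (intro comm_group.cyclic_of_same_system)

end
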